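(* Let $d\in\mathbb{N}$, $p$ a kernel and $\xi$ noise as in the context. Let $\nu\in\mathcal{I}$ satisfy $E^\nu|\eta(x)|<\infty$ for all $x\in\mathbb{Z}^d$, and suppose there exists $u\in\mathcal{H}_d$ such that \[\lim_{r\to\infty}r^{-1/2}\max_{x\in\mathbb{Z}^d:|x|\le r}E^\nu\bigl\{|\eta(x)-u(x)|\bigr\}=0.\] Then the same limit holds with $u(x)$ replaced by $\bar u(x)=E^\nu[\eta(x)]$, and there exists a probability measure $\gamma$ on $\mathbb{R}^d$ such that $\nu=\int_{\mathbb{R}^d}\pi_{\bar u+\alpha}\,\gamma(d\alpha)$.
   Context: The kernel $p:\mathbb{Z}^d\to[0,1)$ satisfies $\sum_x p(x)=1$, $p(x)=0$ for $|x|>M$ for some $M<\infty$, and strong aperiodicity: for every $u\in\mathbb{Z}^d$ the smallest additive subgroup of $\mathbb{Z}^d$ containing $\{u+x:p(x)>0\}$ is $\mathbb{Z}^d$; $p(x,y)=p(y-x)$, $p^k$ the $k$-step transition. $\xi=\{\xi_t(x)\}_{t\in\mathbb{Z},x\in\mathbb{Z}^d}$ are i.i.d. real, mean zero, finite variance. Configurations $\eta\in(\mathbb{R}^d)^{\mathbb{Z}^d}$ are written $\eta(x)=(\eta(x-e_i,x))_{i=1}^d\in\mathbb{R}^d$, with $|\cdot|$ the Euclidean norm. The increment Markov chain evolves by $\eta_{t+1}(x-e_i,x)=\sum_z p(0,z)\eta_t(x+z-e_i,x+z)+\xi_{t+1}(x)-\xi_{t+1}(x-e_i)$, $\xi_{t+1}$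 independent of $\eta_t$; $\mathcal{I}$ is the set of probability measures on $(\mathbb{R}^d)^{\mathbb{Z}^d}$ invariant for this chain. $\mathcal{H}_d$ is the set of $u=(u_1,\dots,u_d)$, $u_i:\mathbb{Z}^d\to\mathbb{R}$ with $\sum_y p(x,y)u_i(y)=u_i(x)$ for all $x$. $\Delta_0(x-e_i,x)=\sum_{k\ge 0}\sum_z\xi_{-k}(z)(p^k(x,z)-p^k(x-e_i,z))$. For a function $v:\mathbb{Z}^d\to\mathbb{R}^d$, $\pi_v$ denotes the law of the configuration $\{v_i(x)+\Delta_0(x-e_i,x)\}_{x\in\mathbb{Z}^d,i\le d}$; $\bar u+\alpha$ means $x\mapsto\bar u(x)+\alpha$. *)

theory Defs
  imports "HOL-Probability.Probability"
begin

(* Sites of Z^d are int^'d ('d a finite index type of cardinality d).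
   A configuration eta maps a site x to the vector
   eta(x) = (eta(x - e_i, x))_{i} in real^'d. *)

definition unitv :: "'d::finite \<Rightarrow> int^'d" where
  "unitv i = (\<chi> j. if j = i then 1 else 0)"

definition znorm :: "int^'d::finite \<Rightarrow> real" where
  "znorm x = norm (\<chi> i. real_of_int (x $ i))"

definition addgroup_gen :: "(int^'d::finite) set \<Rightarrow> (int^'d) set" where
  "addgroup_gen S = \<Inter>{H. S \<subseteq> H \<and> 0 \<in> H \<and> (\<forall>a\<in>H. \<forall>b\<in>H. a - b \<in> H)}"

definition supp :: "(int^'d::finite \<Rightarrow> real) \<Rightarrow> (int^'d) set" where
  "supp p = {z. p z \<noteq> 0}"

(* the standing assumptions on the kernel p(x,y) = p(y - x) *)
definition kernel :: "(int^'d::finite \<Rightarrow> real) \<Rightarrow> bool" where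
  "kernel p \<longleftrightarrow>
     (\<forall>x. 0 \<le> p x \<and> p x < 1) \<and>
     (\<exists>M. \<forall>x. znorm x > M \<longrightarrow> p x = 0) \<and>
     (\<Sum>z\<in>supp p. p z) = 1 \<and>
     (\<forall>u. addgroup_gen {u + x | x. p x > 0} = UNIV)"

(* k-step transition: p^k(x,y) = pk p k (y - x) *)
fun pk :: "(int^'d::finite \<Rightarrow> real) \<Rightarrow> nat \<Rightarrow> int^'d \<Rightarrow> real" where
  "pk p 0 z = (if z = 0 then 1 else 0)"
| "pk p (Suc k) z = (\<Sum>w\<in>supp p. p w * pk p k (z - w))"

abbreviation CS :: "(int^'d::finite \<Rightarrow> real^'d) measure" where
  "CS \<equiv> Pi\<^sub>M UNIV (\<lambda>_. borel)"

abbreviation noise_slice :: "real measure \<Rightarrow> (int^'d::finite \<Rightarrow> real) measure" where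
  "noise_slice \<mu> \<equiv> Pi\<^sub>M UNIV (\<lambda>_. \<mu>)"

(* one step of the increment chain, with new noise zeta = xi_{t+1} *)
definition step :: "(int^'d::finite \<Rightarrow> real) \<Rightarrow> (int^'d \<Rightarrow> real^'d) \<Rightarrow> (int^'d \<Rightarrow> real)
                    \<Rightarrow> int^'d \<Rightarrow> real^'d" where
  "step p eta zeta x = (\<chi> i. (\<Sum>z\<in>supp p. p z * (eta (x + z) $ i)) + zeta x - zeta (x - unitv i))"

definition invariant :: "(int^'d::finite \<Rightarrow> real) \<Rightarrow> real measure \<Rightarrow> (int^'d \<Rightarrow> real^'d) measure \<Rightarrow> bool" where
  "invariant p \<mu> \<nu> \<longleftrightarrow> prob_space \<nu> \<and> sets \<nu> = sets CS \<and>
     distr (\<nu> \<Otimes>\<^sub>M noise_slice \<mu>) CS (\<lambda>(eta, zeta). step p eta zeta) = \<nu>"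

definition harmonic :: "(int^'d::finite \<Rightarrow> real) \<Rightarrow> (int^'d \<Rightarrow> real^'d) \<Rightarrow> bool" where
  "harmonic p u \<longleftrightarrow> (\<forall>x. (\<Sum>z\<in>supp p. p z *\<^sub>R u (x + z)) = u x)"

(* the noise in the past: omega k z = xi_{-k}(z), k >= 0 *)
abbreviation past_noise :: "real measure \<Rightarrow> (nat \<Rightarrow> int^'d::finite \<Rightarrow> real) measure" where
  "past_noise \<mu> \<equiv> Pi\<^sub>M UNIV (\<lambda>_::nat. noise_slice \<mu>)"

(* Delta_0(x - e_i, x) = sum_{k>=0} sum_z xi_{-k}(z) (p^k(x,z) - p^k(x - e_i,z)) ;
   (the series converges almost surely; we set 0 where it does not converge) *)
definition Delta0 :: "(int^'d::finite \<Rightarrow> real) \<Rightarrow> (nat \<Rightarrow> int^'d \<Rightarrow> real) \<Rightarrow> int^'d \<Rightarrow> real^'d" where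
  "Delta0 p \<omega> x = (\<chi> i.
     (let a = (\<lambda>k. \<Sum>z\<in>{z. pk p k (z - x) \<noteq> 0 \<or> pk p k (z - (x - unitv i)) \<noteq> 0}.
                       \<omega> k z * (pk p k (z - x) - pk p k (z - (x - unitv i))))
      in if summable a then suminf a else 0))"

definition piv :: "(int^'d::finite \<Rightarrow> real) \<Rightarrow> real measure \<Rightarrow> (int^'d \<Rightarrow> real^'d) \<Rightarrow> (int^'d \<Rightarrow> real^'d) measure" where
  "piv p \<mu> v = distr (past_noise \<mu>) CS (\<lambda>\<omega> x. v x + Delta0 p \<omega> x)"

definition dev :: "(int^'d::finite \<Rightarrow> real^'d) measure \<Rightarrow> (int^'d \<Rightarrow> real^'d) \<Rightarrow> real \<Rightarrow> real" where
  "dev \<nu> w r = r powr (-1/2) * Max ((\<lambda>x. \<integral>eta. norm (eta x - w x) \<partial>\<nu>) ` {x. znorm x \<le> r})"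

end

theory Submission
  imports Defs
begin

text \<open>Write \<open>\<zeta> = \<eta> - u\<close> and let \<open>P\<close> be the averaging operator of the kernel. Stationarity and
  harmonicity of \<open>u\<close> give \<open>\<eta> = u + P\<^sup>t \<zeta> + D\<^sub>t\<close> in law for every \<open>t\<close>, where \<open>D\<^sub>t\<close> is independent of
  \<open>\<zeta>\<close> and, with the noise indexed backwards in time, converges almost surely to \<open>\<Delta>\<^sub>0\<close>. Since translates
  of \<open>p\<^sup>t\<close> differ by \<open>O(t\<^sup>-\<^sup>1\<^sup>/\<^sup>2)\<close> in total variation and \<open>p\<^sup>t\<close> lives on a ball of radius \<open>O(t)\<close>, where
  \<open>E|\<zeta>| = o(t\<^sup>1\<^sup>/\<^sup>2)\<close>, the field \<open>P\<^sup>t \<zeta>\<close> becomes flat in \<open>L\<^sup>1\<close>. Its value at the origin is Cauchy in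
  \<open>L\<^sup>1\<close>, because replacing \<open>\<zeta>\<close> by \<open>P\<^sup>s \<zeta> + D\<^sub>s\<close> with \<open>s\<close> large leaves only the noise term \<open>P\<^sup>t D\<^sub>s\<close>,
  which is small uniformly in \<open>s\<close>. So \<open>P\<^sup>t \<zeta>\<close> tends to a random constant independent of \<open>\<Delta>\<^sub>0\<close>, whose law,
  centred, is \<open>\<gamma>\<close>.\<close>

section \<open>Averaging operators and smoothing\<close>

text \<open>The two square roots are matched: smoothing gains \<open>C / sqrt (t + 1)\<close>, the
  fluctuation on the range of the walk costs \<open>e * sqrt t\<close>, and the product is small
  only because \<open>e\<close> is arbitrary. Neither kernel estimate needs a local limit theorem or
  depends on the dimension. Total variation comes from a score function, and square summability of
  translation differences (which makes \<open>Delta0\<close> converge) from a decreasing energy.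
  Both arguments compare two points of the support; strong aperiodicity enters only as the fact that
  such differences generate the lattice, and both estimates survive subtraction of displacements.
  The obstacle is that \<open>E|fluct|\<close> may grow with the site, so flatness alone gives
  neither tightness nor a limit at the origin; stationarity must supply it. Indexing noise by age
  lets one \<open>omega\<close> serve all times: the noise part is then a partial sum of independent
  terms with an almost sure limit. As \<open>eta\<close> and \<open>omega\<close> live on the two
  factors of a product space, the independence of the random constant from \<open>Delta0\<close> is
  automatic, and a subsequence suffices because every evolved field has exactly the law
  \<open>\<nu>\<close>.\<close>

lemma znorm_zero [simp]: "znorm 0 = 0"
proof -
  have "(\<chi> i. real_of_int ((0::int^'d) $ i)) = (0::real^'d)"
    by (simp add: vec_eq_iff)
  then show ?thesis
    by (simp add: znorm_def)
qed

lemma znorm_nonneg [simp]: "0 \<le> znorm x"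
  by (simp add: znorm_def)

lemma znorm_add: "znorm (x + y) \<le> znorm x + znorm y"
proof -
  have "(\<chi> i. real_of_int ((x + y) $ i)) = (\<chi> i. real_of_int (x $ i)) + (\<chi> i. real_of_int (y $ i))"
    by (simp add: vec_eq_iff)
  then show ?thesis
    unfolding znorm_def using norm_triangle_ineq by metis
qed

lemma finite_znorm_ball: "finite {x :: int^'d::finite. znorm x \<le> r}"
proof (rule finite_subset)
  let ?S = "PiE (UNIV :: 'd set) (\<lambda>_. {-\<lceil>r\<rceil>..\<lceil>r\<rceil>})"
  show "finite ((\<lambda>f. \<chi> i. f i) ` ?S)"
    by (intro finite_imageI finite_PiE) auto
  show "{x :: int^'d. znorm x \<le> r} \<subseteq> (\<lambda>f. \<chi> i. f i) ` ?S"
  proof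
    fix x :: "int^'d"
    assume "x \<in> {x. znorm x \<le> r}"
    then have "\<bar>real_of_int (x $ i)\<bar> \<le> r" for i
      using component_le_norm_cart[of "\<chi> i. real_of_int (x $ i)" i] by (simp add: znorm_def)
    then have "\<bar>real_of_int (x $ i)\<bar> \<le> real_of_int \<lceil>r\<rceil>" for i
      using le_of_int_ceiling order_trans by blast
    then have "\<bar>x $ i\<bar> \<le> \<lceil>r\<rceil>" for i
      by (metis of_int_abs of_int_le_iff)
    then have "x $ i \<in> {-\<lceil>r\<rceil>..\<lceil>r\<rceil>}" for i
      by (simp add: abs_le_iff minus_le_iff)
    then show "x \<in> (\<lambda>f. \<chi> i. f i) ` ?S"
      by (intro image_eqI[of _ _ "\<lambda>i. x $ i"]) (auto simp: vec_eq_iff)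
  qed
qed

text \<open>Kernel powers as operators rather than as sums against \<open>pk\<close>, so that no
  support has to be carried along. The range is any real vector space: the same operator acts on
  vector configurations, scalar noise and test functions.\<close>

primrec avg :: "(int^'d::finite \<Rightarrow> real) \<Rightarrow> nat \<Rightarrow> (int^'d \<Rightarrow> 'b::real_vector) \<Rightarrow> int^'d \<Rightarrow> 'b" where
  "avg p 0 f = f"
| "avg p (Suc t) f = (\<lambda>x. \<Sum>w\<in>supp p. p w *\<^sub>R avg p t f (x + w))"

lemma avg_translate: "avg p t (\<lambda>y. f (y + a)) x = avg p t f (x + a)"
  by (induction t arbitrary: x) (simp_all add: add_ac)

lemma avg_avg: "avg p s (avg p t f) = avg p (s + t) f"
  by (induction s) simp_all

lemma avg_add: "avg p t (\<lambda>y. f y + g y) x = avg p t f x + avg p t g x"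
  by (induction t arbitrary: x) (simp_all add: scaleR_add_right sum.distrib)

lemma avg_diff: "avg p t (\<lambda>y. f y - g y) x = avg p t f x - avg p t g x"
  by (induction t arbitrary: x) (simp_all add: scaleR_diff_right sum_subtractf)

lemma avg_sum: "avg p t (\<lambda>y. \<Sum>i\<in>I. f i y) x = (\<Sum>i\<in>I. avg p t (f i) x)"
  by (induction I rule: infinite_finite_induct)
    (simp_all add: avg_add, induction t arbitrary: x, simp_all,
     induction t arbitrary: x, simp_all)

lemma avg_nth: "avg p t f x $ i = avg p t (\<lambda>y. f y $ i) x"
  by (induction t arbitrary: x) simp_all

lemma avg_harmonic: "harmonic p u \<Longrightarrow> avg p t u = u"
  by (induction t) (auto simp: harmonic_def)

lemma
  fixes f :: "'a \<Rightarrow> int^'d::finite \<Rightarrow> 'b::{banach, second_countable_topology}"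
  assumes "\<And>x. integrable M (\<lambda>\<omega>. f \<omega> x)"
  shows integrable_avg: "integrable M (\<lambda>\<omega>. avg p t (f \<omega>) x)"
    and integral_avg: "(\<integral>\<omega>. avg p t (f \<omega>) x \<partial>M) = avg p t (\<lambda>y. \<integral>\<omega>. f \<omega> y \<partial>M) x"
  by (induction t arbitrary: x) (simp_all add: assms)

lemma measurable_avg [measurable]:
  fixes f :: "'a \<Rightarrow> int^'d::finite \<Rightarrow> 'b::{second_countable_topology, real_normed_vector}"
  assumes "\<And>x. (\<lambda>\<omega>. f \<omega> x) \<in> borel_measurable M"
  shows "(\<lambda>\<omega>. avg p t (f \<omega>) x) \<in> borel_measurable M"
  by (induction t arbitrary: x) (simp_all add: assms)

section \<open>Kernel powers, their supports, and generation of the lattice\<close>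

locale rw_kernel =
  fixes p :: "int^'d::finite \<Rightarrow> real"
  assumes kern: "kernel p"
begin

lemma p_nonneg [simp]: "0 \<le> p x"
  using kern by (auto simp: kernel_def)

lemma finite_supp [simp]: "finite (supp p)"
proof -
  obtain M where "\<And>x. znorm x > M \<Longrightarrow> p x = 0"
    using kern by (auto simp: kernel_def)
  then have "supp p \<subseteq> {x. znorm x \<le> M}"
    by (force simp: supp_def)
  then show ?thesis
    using finite_znorm_ball finite_subset by blast
qed

lemma sum_p: "(\<Sum>z\<in>supp p. p z) = 1"
  using kern by (auto simp: kernel_def)

definition reach :: real where
  "reach = (SOME M. 0 \<le> M \<and> (\<forall>x. znorm x > M \<longrightarrow> p x = 0))"

lemma reach: "0 \<le> reach" "p x \<noteq> 0 \<Longrightarrow> znorm x \<le> reach"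
proof -
  obtain M where "\<And>x. znorm x > M \<Longrightarrow> p x = 0"
    using kern by (auto simp: kernel_def)
  then have "0 \<le> max 0 M \<and> (\<forall>x. znorm x > max 0 M \<longrightarrow> p x = 0)"
    by auto
  then have "0 \<le> reach \<and> (\<forall>x. znorm x > reach \<longrightarrow> p x = 0)"
    unfolding reach_def by (rule someI)
  then show "0 \<le> reach" "p x \<noteq> 0 \<Longrightarrow> znorm x \<le> reach"
    by force+
qed

lemma pk_nonneg [simp]: "0 \<le> pk p t z"
  by (induction t arbitrary: z) (auto intro: sum_nonneg)

lemma znorm_le_of_pk: "pk p t z \<noteq> 0 \<Longrightarrow> znorm z \<le> t * reach"
proof (induction t arbitrary: z)
  case 0
  then show ?case by (auto split: if_splits)
next
  case (Suc t)
  then obtain w where w: "w \<in> supp p" "p w * pk p t (z - w) \<noteq> 0"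
    using sum.not_neutral_contains_not_neutral[of "\<lambda>w. p w * pk p t (z - w)" "supp p"] by auto
  then have "znorm (z - w) \<le> t * reach" "znorm w \<le> reach"
    using Suc.IH[of "z - w"] reach(2)[of w] by auto
  then show ?case
    using znorm_add[of "z - w" w] by (simp add: algebra_simps)
qed

lemma finite_pk [simp]: "finite {z. pk p t (z - x) \<noteq> 0}"
proof (rule finite_subset)
  show "{z. pk p t (z - x) \<noteq> 0} \<subseteq> {z. znorm z \<le> t * reach + znorm x}"
  proof safe
    fix z assume "pk p t (z - x) \<noteq> 0"
    from znorm_le_of_pk[OF this] show "znorm z \<le> t * reach + znorm x"
      using znorm_add[of "z - x" x] by simp
  qed
qed (rule finite_znorm_ball)

lemma avg_eq_sum:
  assumes "finite B" "{z. pk p t (z - x) \<noteq> 0} \<subseteq> B"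
  shows "avg p t f x = (\<Sum>z\<in>B. pk p t (z - x) *\<^sub>R f z)"
  using assms
proof (induction t arbitrary: x B)
  case 0
  then have x: "x \<in> B" by auto
  have "(\<Sum>z\<in>B. pk p 0 (z - x) *\<^sub>R f z) = (\<Sum>z\<in>B. if x = z then f z else 0)"
    by (intro sum.cong) auto
  then show ?case
    using 0 x by simp
next
  case (Suc t)
  \<comment> \<open>One range large enough for \<open>x\<close> and for every \<open>x + w\<close>,
    so that the two sums can be swapped.\<close>
  define D where "D = B \<union> (\<Union>w\<in>supp p. {z. pk p t (z - (x + w)) \<noteq> 0})"
  have D: "finite D" "B \<subseteq> D"
    unfolding D_def using Suc.prems by auto
  have "(\<Sum>z\<in>B. pk p (Suc t) (z - x) *\<^sub>R f z) = (\<Sum>z\<in>D. pk p (Suc t) (z - x) *\<^sub>R f z)"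
    using D Suc.prems(2) by (intro sum.mono_neutral_left) auto
  also have "\<dots> = (\<Sum>z\<in>D. \<Sum>w\<in>supp p. p w *\<^sub>R pk p t (z - (x + w)) *\<^sub>R f z)"
    by (simp add: scaleR_sum_left diff_diff_eq)
  also have "\<dots> = (\<Sum>w\<in>supp p. \<Sum>z\<in>D. p w *\<^sub>R pk p t (z - (x + w)) *\<^sub>R f z)"
    by (rule sum.swap)
  also have "\<dots> = (\<Sum>w\<in>supp p. p w *\<^sub>R avg p t f (x + w))"
    unfolding scaleR_sum_right[symmetric]
    by (intro sum.cong refl arg_cong[where f = "scaleR _"] Suc.IH[symmetric] D) (auto simp: D_def)
  finally show ?case by simp
qed

lemma avg_const: "avg p t (\<lambda>_. c) x = c"
  by (induction t arbitrary: x) (simp_all add: sum_p flip: scaleR_sum_left)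

lemma norm_avg_le: "norm (avg p t f x) \<le> avg p t (\<lambda>y. norm (f y)) x"
proof (induction t arbitrary: x)
  case (Suc t)
  have "norm (avg p (Suc t) f x) \<le> (\<Sum>w\<in>supp p. norm (p w *\<^sub>R avg p t f (x + w)))"
    unfolding avg.simps by (rule norm_sum)
  also have "\<dots> \<le> (\<Sum>w\<in>supp p. p w * avg p t (\<lambda>y. norm (f y)) (x + w))"
    by (intro sum_mono) (auto intro!: mult_left_mono Suc)
  finally show ?case by simp
qed simp

lemma avg_diff_eq_sum:
  assumes "finite B" "{z. pk p t (z - x) \<noteq> 0 \<or> pk p t (z - y) \<noteq> 0} \<subseteq> B"
  shows "avg p t f x - avg p t f y = (\<Sum>z\<in>B. (pk p t (z - x) - pk p t (z - y)) *\<^sub>R f z)"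
proof -
  have "avg p t f x = (\<Sum>z\<in>B. pk p t (z - x) *\<^sub>R f z)" "avg p t f y = (\<Sum>z\<in>B. pk p t (z - y) *\<^sub>R f z)"
    using assms by (intro avg_eq_sum; auto)+
  then show ?thesis
    by (simp add: sum_subtractf scaleR_diff_left)
qed

text \<open>Strong aperiodicity is used at \<open>u = - z\<close> for one support point
  \<open>z\<close>: the translated support then consists of differences of support points. This is
  the induction principle for both translation estimates.\<close>

lemma generation:
  assumes "\<And>z1 z2. p z1 > 0 \<Longrightarrow> p z2 > 0 \<Longrightarrow> z1 - z2 \<in> H"
    and "0 \<in> H" "\<And>a b. a \<in> H \<Longrightarrow> b \<in> H \<Longrightarrow> a - b \<in> H"
  shows "x \<in> H"
proof -
  obtain z where z: "p z \<noteq> 0"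
    using sum_p by (metis sum.neutral zero_neq_one)
  then have "p z > 0"
    using p_nonneg[of z] by linarith
  then have "{- z + x | x. p x > 0} \<subseteq> H"
    using assms(1)[of _ z] by auto
  then have "addgroup_gen {- z + x | x. p x > 0} \<subseteq> H"
    unfolding addgroup_gen_def using assms by (intro Inter_lower) auto
  then show ?thesis
    using kern unfolding kernel_def by blast
qed

text \<open>Expectation of \<open>F\<close> at the end of a \<open>t\<close>-step walk from
  \<open>x\<close>, with the additive functional \<open>n + \<Sum> h(steps)\<close> as second
  argument. The recursion replaces a measure on paths.\<close>

primrec wavg :: "(int^'d \<Rightarrow> real) \<Rightarrow> nat \<Rightarrow> (int^'d \<Rightarrow> real \<Rightarrow> real) \<Rightarrow> int^'d \<Rightarrow> real \<Rightarrow> real" where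
  "wavg h 0 F x n = F x n"
| "wavg h (Suc t) F x n = (\<Sum>w\<in>supp p. p w * wavg h t F (x + w) (n + h w))"

lemma abs_wavg_le:
  assumes "\<And>x n. \<bar>F x n\<bar> \<le> G x n"
  shows "\<bar>wavg h t F x n\<bar> \<le> wavg h t G x n"
proof (induction t arbitrary: x n)
  case (Suc t)
  have "\<bar>wavg h (Suc t) F x n\<bar> \<le> (\<Sum>w\<in>supp p. \<bar>p w * wavg h t F (x + w) (n + h w)\<bar>)"
    by simp
  also have "\<dots> \<le> (\<Sum>w\<in>supp p. p w * wavg h t G (x + w) (n + h w))"
    by (intro sum_mono) (auto simp: abs_mult intro!: mult_left_mono Suc)
  finally show ?case by simp
qed (simp add: assms)

text \<open>Scores of distinct steps are independent and centred, so second moments add. The shape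
  \<open>a * n\<^sup>2 + b\<close> is that of the quadratic majorant of \<open>|n|\<close> to be
  inserted.\<close>

lemma wavg_square:
  assumes "(\<Sum>w\<in>supp p. p w * h w) = 0"
  shows "wavg h t (\<lambda>_ n. a * n\<^sup>2 + b) x n = a * (n\<^sup>2 + t * (\<Sum>w\<in>supp p. p w * (h w)\<^sup>2)) + b"
proof (induction t arbitrary: x n)
  case (Suc t)
  let ?s = "\<Sum>w\<in>supp p. p w * (h w)\<^sup>2"
  have "wavg h (Suc t) (\<lambda>_ n. a * n\<^sup>2 + b) x n
      = (\<Sum>w\<in>supp p. (a * (n\<^sup>2 + t * ?s) + b) * p w + 2 * a * n * (p w * h w) + a * (p w * (h w)\<^sup>2))"
    unfolding wavg.simps Suc by (intro sum.cong) (simp_all add: algebra_simps power2_eq_square)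
  also have "\<dots> = (a * (n\<^sup>2 + t * ?s) + b) + a * ?s"
    by (simp add: sum.distrib sum_distrib_left[symmetric] sum_p assms)
  finally show ?case
    by (simp add: algebra_simps)
qed simp

text \<open>The hypothesis says that weighting a step by \<open>h\<close> replaces its law by the
  signed measure putting 1 at \<open>z1\<close> and -1 at \<open>z2\<close>. Steps commute, so each
  of the \<open>t\<close> steps contributes the same difference of \<open>(t - 1)\<close>-step
  averages.\<close>

lemma wavg_times:
  assumes h: "\<And>F. (\<Sum>w\<in>supp p. p w * h w * F w) = F z1 - (F z2 :: real)"
  shows "wavg h t (\<lambda>x n. n * g x) x n
       = n * avg p t g x + t * (avg p (t - 1) g (x + z1) - avg p (t - 1) g (x + z2))"
proof (induction t arbitrary: x n)
  case (Suc t)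
  \<comment> \<open>At \<open>t = 0\<close> the truncated predecessor is harmless because of the
    factor \<open>t\<close>.\<close>
  have *: "t * (\<Sum>w\<in>supp p. p w * avg p (t - Suc 0) g (x + w + z)) = t * avg p t g (x + z)" for z
    by (cases t) (simp_all add: add_ac del: of_nat_Suc)
  have "wavg h (Suc t) (\<lambda>x n. n * g x) x n
      = (\<Sum>w\<in>supp p. n * (p w * avg p t g (x + w)) + p w * h w * avg p t g (x + w)
          + t * (p w * avg p (t - 1) g (x + w + z1)) - t * (p w * avg p (t - 1) g (x + w + z2)))"
    unfolding wavg.simps Suc by (intro sum.cong) (simp_all add: algebra_simps)
  also have "\<dots> = n * avg p (Suc t) g x + (avg p t g (x + z1) - avg p t g (x + z2))
      + t * avg p t g (x + z1) - t * avg p t g (x + z2)"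
    by (simp add: sum.distrib sum_subtractf sum_distrib_left[symmetric] h *)
  finally show ?case
    by (simp add: algebra_simps)
qed simp

text \<open>Weighting a path of length \<open>t + 1\<close> by the score \<open>N = \<Sum> h(steps)\<close>, with
  \<open>h = (1\<^bsub>z1\<^esub> - 1\<^bsub>z2\<^esub>) / p\<close>, produces \<open>t + 1\<close> times the difference to be estimated, and
  \<open>|N| \<le> (N\<^sup>2 / \<tau> + \<tau>) / 2\<close> with \<open>\<tau> = \<surd>(t + 1)\<close>.\<close>

lemma avg_smoothing_step:
  assumes z: "p z1 > 0" "p z2 > 0"
  shows "\<exists>C\<ge>0. \<forall>t g x. (\<forall>y. \<bar>g y\<bar> \<le> (1::real)) \<longrightarrow>
    \<bar>avg p t g (x + z1) - avg p t g (x + z2)\<bar> \<le> C / sqrt (t + 1)"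
proof -
  define h where "h w = (of_bool (w = z1) - of_bool (w = z2)) / p w" for w
  define s where "s = (\<Sum>w\<in>supp p. p w * (h w)\<^sup>2)"
  have s: "s \<ge> 0"
    unfolding s_def by (intro sum_nonneg) auto
  have h: "(\<Sum>w\<in>supp p. p w * h w * F w) = F z1 - F z2" for F
  proof -
    have "(\<Sum>w\<in>supp p. p w * h w * F w)
        = (\<Sum>w\<in>supp p. (if w = z1 then F w else 0) - (if w = z2 then F w else 0))"
      by (intro sum.cong) (auto simp: h_def supp_def)
    also have "\<dots> = F z1 - F z2"
      using z by (simp add: sum_subtractf) (simp add: supp_def)
    finally show ?thesis .
  qed
  have h0: "(\<Sum>w\<in>supp p. p w * h w) = 0"
    using h[of "\<lambda>_. 1"] by simp
  show ?thesis
  proof (intro exI[of _ "(s + 1) / 2"] conjI allI impI)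
    fix t :: nat and g :: "int^'d \<Rightarrow> real" and x
    assume g: "\<forall>y. \<bar>g y\<bar> \<le> 1"
    define \<tau> where "\<tau> = sqrt (t + 1)"
    have \<tau>: "\<tau> > 0" "\<tau> * \<tau> = t + 1"
      by (auto simp: \<tau>_def)
    have "\<bar>n * g y\<bar> \<le> 1 / (2 * \<tau>) * n\<^sup>2 + \<tau> / 2" for n y
    proof -
      have "\<bar>n * g y\<bar> \<le> \<bar>n\<bar> * 1"
        using g unfolding abs_mult by (intro mult_left_mono) auto
      also have "\<bar>n\<bar> * 1 \<le> 1 / (2 * \<tau>) * n\<^sup>2 + \<tau> / 2"
        using \<tau>(1) zero_le_power2[of "\<bar>n\<bar> - \<tau>"]
        by (simp add: field_simps power2_eq_square)
      finally show ?thesis .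
    qed
    from abs_wavg_le[where F = "\<lambda>y n. n * g y" and G = "\<lambda>_ n. 1 / (2 * \<tau>) * n\<^sup>2 + \<tau> / 2" and h = h
        and t = "Suc t" and x = x and n = 0, OF this]
    have "\<bar>(t + 1) * (avg p t g (x + z1) - avg p t g (x + z2))\<bar> \<le> 1 / (2 * \<tau>) * ((t + 1) * s) + \<tau> / 2"
      unfolding wavg_times[OF h] wavg_square[OF h0] by (simp add: s_def algebra_simps)
    also have "\<dots> = \<tau> * ((s + 1) / 2)"
      unfolding \<tau>(2)[symmetric] using \<tau>(1) by (simp add: field_simps)
    finally have "(\<tau> * \<tau>) * \<bar>avg p t g (x + z1) - avg p t g (x + z2)\<bar> \<le> \<tau> * ((s + 1) / 2)"
      unfolding \<tau>(2) by (simp add: abs_mult)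
    then have "\<tau> * \<bar>avg p t g (x + z1) - avg p t g (x + z2)\<bar> \<le> (s + 1) / 2"
      unfolding mult.assoc using \<tau>(1) by (rule mult_left_le_imp_le)
    then show "\<bar>avg p t g (x + z1) - avg p t g (x + z2)\<bar> \<le> (s + 1) / 2 / sqrt (t + 1)"
      unfolding \<tau>_def[symmetric] using \<tau>(1) by (simp add: field_simps)
  qed (use s in auto)
qed

text \<open>Displacements admitting such a bound, with a constant depending on \<open>w\<close>, are
  closed under subtraction since constants add; \<open>generation\<close> then reaches every
  \<open>w\<close> from the one-step estimate.\<close>

lemma avg_smoothing:
  "\<exists>C\<ge>0. \<forall>t g x. (\<forall>y. \<bar>g y\<bar> \<le> (1::real)) \<longrightarrow> \<bar>avg p t g (x + w) - avg p t g x\<bar> \<le> C / sqrt (t + 1)"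
proof -
  define H where "H = {w. \<exists>C\<ge>0. \<forall>t g x. (\<forall>y. \<bar>g y\<bar> \<le> (1::real)) \<longrightarrow>
    \<bar>avg p t g (x + w) - avg p t g x\<bar> \<le> C / sqrt (t + 1)}"
  have "w \<in> H"
  proof (rule generation)
    fix z1 z2 assume "p z1 > 0" "p z2 > 0"
    from avg_smoothing_step[OF this] obtain C where C: "C \<ge> 0" "\<And>t g x. (\<forall>y. \<bar>g y\<bar> \<le> 1) \<Longrightarrow>
      \<bar>avg p t g (x + z1) - avg p t g (x + z2)\<bar> \<le> C / sqrt (t + 1)"
      by blast
    have "\<bar>avg p t g (x + (z1 - z2)) - avg p t g x\<bar> \<le> C / sqrt (t + 1)" if "\<forall>y. \<bar>g y\<bar> \<le> 1" for t g x
      using C(2)[OF that, of t "x - z2"] by (simp add: algebra_simps)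
    with C(1) show "z1 - z2 \<in> H"
      by (auto simp: H_def)
  next
    show "0 \<in> H"
      by (auto simp: H_def intro!: exI[of _ 0])
  next
    fix a b assume "a \<in> H" "b \<in> H"
    then obtain C D where C: "C \<ge> 0" "\<And>t g x. (\<forall>y. \<bar>g y\<bar> \<le> 1) \<Longrightarrow>
        \<bar>avg p t g (x + a) - avg p t g x\<bar> \<le> C / sqrt (t + 1)"
      and D: "D \<ge> 0" "\<And>t g x. (\<forall>y. \<bar>g y\<bar> \<le> 1) \<Longrightarrow>
        \<bar>avg p t g (x + b) - avg p t g x\<bar> \<le> D / sqrt (t + 1)"
      unfolding H_def by blast
    have "\<bar>avg p t g (x + (a - b)) - avg p t g x\<bar> \<le> (C + D) / sqrt (t + 1)" if g: "\<forall>y. \<bar>g y\<bar> \<le> 1" for t g x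
      \<comment> \<open>Both \<open>x + (a - b)\<close> and \<open>x\<close> are compared with the
        intermediate point \<open>x - b\<close>.\<close>
      using C(2)[OF g, of t "x - b"] D(2)[OF g, of t "x - b"]
      by (simp add: algebra_simps add_divide_distrib)
    with C(1) D(1) show "a - b \<in> H"
      unfolding H_def by (intro CollectI exI[of _ "C + D"]) auto
  qed
  then show ?thesis
    by (simp add: H_def)
qed

text \<open>Duality: the sign of the difference of the two kernels is an admissible test function in
  \<open>avg_smoothing\<close>, and it turns the difference of averages into the total
  variation.\<close>

lemma pk_l1_difference:
  "\<exists>C\<ge>0. \<forall>t B. finite B \<longrightarrow> (\<Sum>z\<in>B. \<bar>pk p t (z - x) - pk p t (z - y)\<bar>) \<le> C / sqrt (t + 1)"
proof -
  obtain C where C: "C \<ge> 0" "\<And>t g x'. (\<forall>y. \<bar>g y\<bar> \<le> (1::real)) \<Longrightarrow>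
      \<bar>avg p t g (x' + (x - y)) - avg p t g x'\<bar> \<le> C / sqrt (t + 1)"
    using avg_smoothing[of "x - y"] by blast
  have "(\<Sum>z\<in>B. \<bar>pk p t (z - x) - pk p t (z - y)\<bar>) \<le> C / sqrt (t + 1)" if B: "finite B" for t B
  proof -
    define D where "D = B \<union> {z. pk p t (z - x) \<noteq> 0} \<union> {z. pk p t (z - y) \<noteq> 0}"
    define g where "g z = sgn (pk p t (z - x) - pk p t (z - y))" for z
    have "(\<Sum>z\<in>B. \<bar>pk p t (z - x) - pk p t (z - y)\<bar>) \<le> (\<Sum>z\<in>D. \<bar>pk p t (z - x) - pk p t (z - y)\<bar>)"
      using B by (intro sum_mono2) (auto simp: D_def)
    also have "\<dots> = avg p t g x - avg p t g y"
      using B by (subst avg_diff_eq_sum[of D])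
        (auto simp: D_def g_def abs_sgn)
    also have "\<dots> \<le> C / sqrt (t + 1)"
      using C(2)[of g t y] by (auto simp: g_def abs_sgn_eq)
    finally show ?thesis .
  qed
  with C(1) show ?thesis by blast
qed

end

section \<open>Energy estimate and the Kolmogorov one-series theorem\<close>

context rw_kernel
begin

lemma finite_supp_pk [simp]: "finite {z. pk p t z \<noteq> 0}"
  using finite_pk[of t 0] by simp

text \<open>The probability that two independent \<open>t\<close>-step walks with a common start end
  at the same site.\<close>

definition energy :: "nat \<Rightarrow> real" where
  "energy t = (\<Sum>z | pk p t z \<noteq> 0. (pk p t z)\<^sup>2)"

lemma energy_eq:
  assumes "finite B" "{z. pk p t z \<noteq> 0} \<subseteq> B"
  shows "energy t = (\<Sum>z\<in>B. (pk p t z)\<^sup>2)"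
  unfolding energy_def using assms by (intro sum.mono_neutral_left) auto

lemma energy_ge:
  assumes "finite B"
  shows "(\<Sum>z\<in>B. (pk p t (z - w))\<^sup>2) \<le> energy t"
proof -
  let ?A = "(\<lambda>z. z - w) ` B \<union> {z. pk p t z \<noteq> 0}"
  have "(\<Sum>z\<in>B. (pk p t (z - w))\<^sup>2) = (\<Sum>z\<in>(\<lambda>z. z - w) ` B. (pk p t z)\<^sup>2)"
    by (subst sum.reindex) (auto simp: inj_on_def)
  also have "\<dots> \<le> (\<Sum>z\<in>?A. (pk p t z)\<^sup>2)"
    using assms by (intro sum_mono2) auto
  also have "\<dots> = energy t"
    using assms by (intro energy_eq[symmetric]) auto
  finally show ?thesis .
qed

text \<open>Twice the variance is the double sum of \<open>q v * q w * (F v - F w)\<^sup>2\<close>;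
  only the term of the pair \<open>(a, b)\<close> is kept.\<close>

lemma weighted_variance_ge:
  fixes q :: "'a \<Rightarrow> real"
  assumes "finite S" "\<And>w. w \<in> S \<Longrightarrow> 0 \<le> q w" "sum q S = 1" "a \<in> S" "b \<in> S"
  shows "q a * q b * (F a - F b)\<^sup>2 \<le> 2 * ((\<Sum>w\<in>S. q w * (F w)\<^sup>2) - (\<Sum>w\<in>S. q w * F w)\<^sup>2)"
proof -
  let ?m = "\<Sum>w\<in>S. q w * F w"
  have "q a * q b * (F a - F b)\<^sup>2 \<le> (\<Sum>w\<in>S. q a * q w * (F a - F w)\<^sup>2)"
    using assms by (intro member_le_sum[where f = "\<lambda>w. q a * q w * (F a - F w)\<^sup>2"]) auto
  also have "\<dots> \<le> (\<Sum>v\<in>S. \<Sum>w\<in>S. q v * q w * (F v - F w)\<^sup>2)"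
    using assms by (intro member_le_sum[where f = "\<lambda>v. \<Sum>w\<in>S. q v * q w * (F v - F w)\<^sup>2"] sum_nonneg) auto
  also have "\<dots> = (\<Sum>v\<in>S. \<Sum>w\<in>S. q w * (q v * (F v)\<^sup>2) - 2 * ((q v * F v) * (q w * F w)) + q v * (q w * (F w)\<^sup>2))"
    by (intro sum.cong refl) (simp add: power2_eq_square algebra_simps)
  also have "\<dots> = 2 * ((\<Sum>w\<in>S. q w * (F w)\<^sup>2) - ?m\<^sup>2)"
    unfolding sum.distrib sum_subtractf sum_distrib_left[symmetric] sum_distrib_right[symmetric] assms(3)
    by (simp add: power2_eq_square)
  finally show ?thesis .
qed

text \<open>\<open>pk p (Suc t) z\<close> is the \<open>p\<close>-mean over \<open>w\<close> of
  \<open>pk p t (z - w)\<close>, so the energy lost in one step is the sum over \<open>z\<close> of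
  the variances, each bounded below by its pair \<open>(z1, z2)\<close>.\<close>

lemma energy_step:
  assumes "p z1 > 0" "p z2 > 0" "finite B"
  shows "p z1 * p z2 * (\<Sum>z\<in>B. (pk p t (z - z1) - pk p t (z - z2))\<^sup>2) \<le> 2 * (energy t - energy (Suc t))"
proof -
  define D where "D = B \<union> {z. pk p (Suc t) z \<noteq> 0}"
  have D: "finite D"
    using assms finite_supp_pk[of "Suc t"] by (simp add: D_def)
  have z: "z1 \<in> supp p" "z2 \<in> supp p"
    using assms by (auto simp: supp_def)
  have "p z1 * p z2 * (\<Sum>z\<in>B. (pk p t (z - z1) - pk p t (z - z2))\<^sup>2)
      \<le> p z1 * p z2 * (\<Sum>z\<in>D. (pk p t (z - z1) - pk p t (z - z2))\<^sup>2)"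
    using D by (intro mult_left_mono sum_mono2) (auto simp: D_def)
  also have "\<dots> \<le> (\<Sum>z\<in>D. 2 * ((\<Sum>w\<in>supp p. p w * (pk p t (z - w))\<^sup>2) - (\<Sum>w\<in>supp p. p w * pk p t (z - w))\<^sup>2))"
    unfolding sum_distrib_left
    by (intro sum_mono weighted_variance_ge z sum_p) auto
  also have "\<dots> = 2 * ((\<Sum>z\<in>D. \<Sum>w\<in>supp p. p w * (pk p t (z - w))\<^sup>2) - (\<Sum>z\<in>D. (pk p (Suc t) z)\<^sup>2))"
    unfolding sum_subtractf sum_distrib_left[symmetric] by simp
  also have "(\<Sum>z\<in>D. (pk p (Suc t) z)\<^sup>2) = energy (Suc t)"
    by (intro energy_eq[symmetric] D) (auto simp: D_def)
  also have "(\<Sum>z\<in>D. \<Sum>w\<in>supp p. p w * (pk p t (z - w))\<^sup>2) = (\<Sum>w\<in>supp p. p w * (\<Sum>z\<in>D. (pk p t (z - w))\<^sup>2))"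
    unfolding sum_distrib_left by (rule sum.swap)
  also have "\<dots> \<le> (\<Sum>w\<in>supp p. p w * energy t)"
    by (intro sum_mono mult_left_mono energy_ge D) auto
  also have "\<dots> = energy t"
    by (simp add: sum_p flip: sum_distrib_right)
  finally show ?thesis by simp
qed

text \<open>For a difference of two points of the support the energies telescope; the other
  displacements follow because the support differences generate the lattice.\<close>

lemma pk_l2_difference:
  "\<exists>C. \<forall>n B. (\<forall>k. finite (B k)) \<longrightarrow> (\<Sum>k<n. \<Sum>z\<in>B k. (pk p k (z - w) - pk p k z)\<^sup>2) \<le> C"
proof -
  define Q where "Q w C \<longleftrightarrow> (\<forall>n B. (\<forall>k. finite (B k)) \<longrightarrow>
    (\<Sum>k<n. \<Sum>z\<in>B k. (pk p k (z - w) - pk p k z)\<^sup>2) \<le> C)" for w C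
  have Q_shift: "(\<Sum>k<n. \<Sum>z\<in>B k. (pk p k (z - (w + v)) - pk p k (z - v))\<^sup>2) \<le> C"
    if "Q w C" "\<forall>k. finite (B k)" for w v C n and B :: "nat \<Rightarrow> (int^'d) set"
  proof -
    have "(\<Sum>k<n. \<Sum>z\<in>B k. (pk p k (z - (w + v)) - pk p k (z - v))\<^sup>2)
        = (\<Sum>k<n. \<Sum>z\<in>(\<lambda>z. z - v) ` B k. (pk p k (z - w) - pk p k z)\<^sup>2)"
    proof (rule sum.cong, rule refl)
      fix k
      show "(\<Sum>z\<in>B k. (pk p k (z - (w + v)) - pk p k (z - v))\<^sup>2)
          = (\<Sum>z\<in>(\<lambda>z. z - v) ` B k. (pk p k (z - w) - pk p k z)\<^sup>2)"
        by (subst sum.reindex) (auto simp: inj_on_def algebra_simps)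
    qed
    also have "\<dots> \<le> C"
      using that(1)[unfolded Q_def, rule_format, of "\<lambda>k. (\<lambda>z. z - v) ` B k" n] that(2) by simp
    finally show ?thesis .
  qed
  have "w \<in> {w. \<exists>C. Q w C}"
  proof (rule generation)
    fix z1 z2 assume z: "p z1 > 0" "p z2 > 0"
    define c where "c = p z1 * p z2"
    have c: "c > 0"
      using z by (simp add: c_def)
    have "Q (z1 - z2) (2 / c)"
      unfolding Q_def
    proof (intro allI impI)
      fix n and B :: "nat \<Rightarrow> (int^'d) set"
      assume B: "\<forall>k. finite (B k)"
      have "c * (\<Sum>k<n. \<Sum>z\<in>B k. (pk p k (z - (z1 - z2)) - pk p k z)\<^sup>2)
          = (\<Sum>k<n. c * (\<Sum>z\<in>(\<lambda>z. z + z2) ` B k. (pk p k (z - z1) - pk p k (z - z2))\<^sup>2))"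
        by (simp add: sum_distrib_left sum.reindex inj_on_def algebra_simps)
      also have "\<dots> \<le> (\<Sum>k<n. 2 * (energy k - energy (Suc k)))"
        unfolding c_def using B by (intro sum_mono energy_step z) auto
      also have "\<dots> = 2 * (energy 0 - energy n)"
        by (induction n) simp_all
      also have "\<dots> \<le> 2 * energy 0"
        by (simp add: energy_def sum_nonneg)
      also have "energy 0 = 1"
        by (simp add: energy_def)
      finally show "(\<Sum>k<n. \<Sum>z\<in>B k. (pk p k (z - (z1 - z2)) - pk p k z)\<^sup>2) \<le> 2 / c"
        using c by (simp add: field_simps)
    qed
    then show "z1 - z2 \<in> {w. \<exists>C. Q w C}" by blast
  next
    show "0 \<in> {w. \<exists>C. Q w C}"
      by (auto simp: Q_def)
  next
    fix a b assume "a \<in> {w. \<exists>C. Q w C}" "b \<in> {w. \<exists>C. Q w C}"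
    then obtain C D where CD: "Q a C" "Q b D" by blast
    have "Q (a - b) (2 * C + 2 * D)"
      unfolding Q_def
    proof (intro allI impI)
      fix n and B :: "nat \<Rightarrow> (int^'d) set"
      assume B: "\<forall>k. finite (B k)"
      \<comment> \<open>The value at \<open>z + b\<close> is inserted, with
        \<open>(A - B)\<^sup>2 \<le> 2 * A\<^sup>2 + 2 * B\<^sup>2\<close>. Writing
        \<open>a + - b\<close> and \<open>b + - b\<close> fits \<open>Q_shift\<close> with
        \<open>v = - b\<close>.\<close>
      have "(pk p k (z - (a - b)) - pk p k z)\<^sup>2 \<le> 2 * (pk p k (z - (a + - b)) - pk p k (z - - b))\<^sup>2
         + 2 * (pk p k (z - (b + - b)) - pk p k (z - - b))\<^sup>2" for k z
        using zero_le_power2[of "(pk p k (z - (a - b)) - pk p k (z + b)) + (pk p k z - pk p k (z + b))"]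
        by (simp add: power2_eq_square algebra_simps)
      then have "(\<Sum>k<n. \<Sum>z\<in>B k. (pk p k (z - (a - b)) - pk p k z)\<^sup>2)
          \<le> (\<Sum>k<n. \<Sum>z\<in>B k. 2 * (pk p k (z - (a + - b)) - pk p k (z - - b))\<^sup>2
         + 2 * (pk p k (z - (b + - b)) - pk p k (z - - b))\<^sup>2)"
        by (intro sum_mono)
      also have "\<dots> = 2 * (\<Sum>k<n. \<Sum>z\<in>B k. (pk p k (z - (a + - b)) - pk p k (z - - b))\<^sup>2)
         + 2 * (\<Sum>k<n. \<Sum>z\<in>B k. (pk p k (z - (b + - b)) - pk p k (z - - b))\<^sup>2)"
        by (simp add: sum.distrib sum_distrib_left)
      also have "\<dots> \<le> 2 * C + 2 * D"
        by (intro add_mono mult_left_mono Q_shift CD B) auto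
      finally show "(\<Sum>k<n. \<Sum>z\<in>B k. (pk p k (z - (a - b)) - pk p k z)\<^sup>2) \<le> 2 * C + 2 * D" .
    qed
    then show "a - b \<in> {w. \<exists>C. Q w C}" by blast
  qed
  then show ?thesis
    by (simp add: Q_def)
qed

end

text \<open>Partial sums frozen once their absolute value reaches \<open>l\<close>. The recursion
  avoids stopping times and conditional expectations in the maximal inequality.\<close>

primrec stopped :: "real \<Rightarrow> nat \<Rightarrow> (nat \<Rightarrow> real) \<Rightarrow> real" where
  "stopped l 0 x = 0"
| "stopped l (Suc n) x = stopped l n x + (if \<bar>stopped l n x\<bar> < l then x n else 0)"

lemma stopped_cong: "(\<And>i. i < n \<Longrightarrow> x i = y i) \<Longrightarrow> stopped l n x = stopped l n y"
  by (induction n) auto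

lemma measurable_stopped:
  "(\<And>i. i < n \<Longrightarrow> (\<lambda>\<omega>. X i \<omega>) \<in> borel_measurable N) \<Longrightarrow> (\<lambda>\<omega>. stopped l n (\<lambda>i. X i \<omega>)) \<in> borel_measurable N"
  by (induction n) auto

lemma stopped_exceeds:
  assumes "0 < l" "m \<le> n" "l \<le> \<bar>\<Sum>i<m. x i\<bar>"
  shows "l \<le> \<bar>stopped l n x\<bar>"
proof -
  have "stopped l n x = (\<Sum>i<n. x i) \<or> l \<le> \<bar>stopped l n x\<bar>" for n
    by (induction n) (auto simp: algebra_simps)
  then have "l \<le> \<bar>stopped l m x\<bar>"
    using assms by metis
  moreover have "l \<le> \<bar>stopped l (m + j) x\<bar>" if "l \<le> \<bar>stopped l m x\<bar>" for j
    using that by (induction j) auto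
  ultimately show ?thesis
    using assms(2) by (metis le_add_diff_inverse)
qed

section \<open>Kolmogorov's maximal inequality and almost sure convergence of independent
  series\<close>

context prob_space
begin

lemma indep_vars_reindex:
  assumes "indep_vars M' X (range f)" "inj f"
  shows "indep_vars (\<lambda>i. M' (f i)) (\<lambda>i. X (f i)) UNIV"
proof -
  define F where "F i = {X i -` A \<inter> space M | A. A \<in> sets (M' i)}" for i
  have "indep_sets F (range f)"
    using assms unfolding indep_vars_def2 F_def by auto
  have "indep_sets (\<lambda>i. F (f i)) UNIV"
  proof (rule indep_setsI)
    show "F (f i) \<subseteq> events" for i
      using \<open>indep_sets F (range f)\<close> unfolding indep_sets_def by auto
    fix A J assume J: "J \<noteq> {}" "finite J" "\<forall>j\<in>J. A j \<in> F (f j)"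
    have "prob (\<Inter>j\<in>f ` J. A (inv f j)) = (\<Prod>j\<in>f ` J. prob (A (inv f j)))"
      using J assms(2) by (intro indep_setsD[OF \<open>indep_sets F (range f)\<close>]) auto
    moreover have "(\<Prod>j\<in>f ` J. prob (A (inv f j))) = (\<Prod>j\<in>J. prob (A j))"
      using assms(2) by (subst prod.reindex) (auto simp: inj_on_def)
    moreover have "(\<Inter>j\<in>f ` J. A (inv f j)) = (\<Inter>j\<in>J. A j)"
      using assms(2) by simp
    ultimately show "prob (\<Inter>j\<in>J. A j) = (\<Prod>j\<in>J. prob (A j))"
      by simp
  qed
  moreover have "random_variable (M' (f i)) (X (f i))" for i
    using assms(1) unfolding indep_vars_def2 by blast
  ultimately show ?thesis
    unfolding indep_vars_def2 F_def by simp
qed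

text \<open>Each increment is \<open>X n\<close> times an event determined by the earlier variables.
  The cross term therefore has mean zero, and freezing can only remove variance.\<close>

lemma
  fixes X :: "nat \<Rightarrow> 'a \<Rightarrow> real"
  assumes ind: "indep_vars (\<lambda>_. borel) X (UNIV :: nat set)"
    and X: "\<And>i. integrable M (\<lambda>\<omega>. (X i \<omega>)\<^sup>2)" "\<And>i. expectation (X i) = 0"
  shows integrable_stopped_square: "integrable M (\<lambda>\<omega>. (stopped l n (\<lambda>i. X i \<omega>))\<^sup>2)" (is "?I n")
    and expectation_stopped_square:
      "expectation (\<lambda>\<omega>. (stopped l n (\<lambda>i. X i \<omega>))\<^sup>2) \<le> (\<Sum>i<n. expectation (\<lambda>\<omega>. (X i \<omega>)\<^sup>2))" (is "?E n")
proof -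
  have [measurable]: "X i \<in> borel_measurable M" for i
    using ind by (auto simp: indep_vars_def)
  have S: "(\<lambda>\<omega>. stopped l n (\<lambda>i. X i \<omega>)) \<in> borel_measurable M" for n
    by (rule measurable_stopped) auto
  have Xi: "integrable M (X i)" for i
    using square_integrable_imp_integrable[OF _ X(1)] by simp
  have "?I n \<and> ?E n"
  proof (induction n)
    case (Suc n)
    define Y where "Y \<omega> = stopped l n (\<lambda>i. X i \<omega>)" for \<omega>
    define Z where "Z \<omega> = (if \<bar>Y \<omega>\<bar> < l then Y \<omega> else 0)" for \<omega>
    define f where "f x = (let y = stopped l n x in if \<bar>y\<bar> < l then y else 0)" for x
    have [measurable]: "Y \<in> borel_measurable M"
      unfolding Y_def by (rule S)
    then have [measurable]: "Z \<in> borel_measurable M"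
      unfolding Z_def by measurable
    \<comment> \<open>\<open>Z\<close> depends on the block of indices below \<open>n\<close>, and
      \<open>X n\<close> on the disjoint block \<open>{n}\<close>. The cutoff in \<open>Z\<close>
      also makes it bounded, hence integrable.\<close>
    have "indep_var borel (f \<circ> (\<lambda>\<omega>. restrict (\<lambda>i. X i \<omega>) {..<n})) borel ((\<lambda>x. x n) \<circ> (\<lambda>\<omega>. restrict (\<lambda>i. X i \<omega>) {n}))"
    proof (rule indep_var_compose[OF indep_var_restrict[OF ind]])
      have "(\<lambda>x. stopped l n (\<lambda>i. x i)) \<in> borel_measurable (Pi\<^sub>M {..<n} (\<lambda>_. borel))"
        by (rule measurable_stopped) (auto intro: measurable_component_singleton)
      then show "f \<in> borel_measurable (Pi\<^sub>M {..<n} (\<lambda>_. borel))"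
        unfolding f_def Let_def by measurable
    qed auto
    also have "f \<circ> (\<lambda>\<omega>. restrict (\<lambda>i. X i \<omega>) {..<n}) = Z"
      unfolding f_def Z_def Y_def comp_def Let_def
      by (intro ext) (simp cong: stopped_cong)
    also have "(\<lambda>x. x n) \<circ> (\<lambda>\<omega>. restrict (\<lambda>i. X i \<omega>) {n}) = X n"
      by auto
    finally have indep: "indep_var borel Z borel (X n)" .
    have Z: "integrable M Z"
      by (rule integrable_const_bound[of _ "\<bar>l\<bar>"]) (auto simp: Z_def)
    have ZX: "integrable M (\<lambda>\<omega>. Z \<omega> * X n \<omega>)" "expectation (\<lambda>\<omega>. Z \<omega> * X n \<omega>) = 0"
      using indep_var_integrable[OF indep Z Xi] indep_var_lebesgue_integral[OF indep Z Xi] X(2) by auto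
    have I: "integrable M (\<lambda>\<omega>. (Y \<omega>)\<^sup>2)" and E: "expectation (\<lambda>\<omega>. (Y \<omega>)\<^sup>2) \<le> (\<Sum>i<n. expectation (\<lambda>\<omega>. (X i \<omega>)\<^sup>2))"
      using Suc by (auto simp: Y_def)
    define V where "V \<omega> = (if \<bar>Y \<omega>\<bar> < l then (X n \<omega>)\<^sup>2 else 0)" for \<omega>
    have V: "integrable M V"
      by (rule Bochner_Integration.integrable_bound[OF X(1)[of n]]) (auto simp: V_def[abs_def])
    \<comment> \<open>The indicator of not yet being frozen multiplies both \<open>X n\<close> and
      its square, which gives the terms with \<open>Z\<close> and \<open>V\<close>.\<close>
    have eq: "(stopped l (Suc n) (\<lambda>i. X i \<omega>))\<^sup>2 = (Y \<omega>)\<^sup>2 + 2 * (Z \<omega> * X n \<omega>) + V \<omega>" for \<omega>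
      by (simp add: Y_def Z_def V_def power2_sum)
    have "expectation (\<lambda>\<omega>. (stopped l (Suc n) (\<lambda>i. X i \<omega>))\<^sup>2) = expectation (\<lambda>\<omega>. (Y \<omega>)\<^sup>2) + expectation V"
      unfolding eq using I ZX V by simp
    also have "expectation V \<le> expectation (\<lambda>\<omega>. (X n \<omega>)\<^sup>2)"
      by (intro integral_mono V X(1)) (auto simp: V_def)
    finally show ?case
      using I E ZX V unfolding eq by auto
  qed simp
  then show "?I n" "?E n" by auto
qed

lemma kolmogorov_inequality:
  fixes X :: "nat \<Rightarrow> 'a \<Rightarrow> real"
  assumes ind: "indep_vars (\<lambda>_. borel) X (UNIV :: nat set)"
    and X: "\<And>i. integrable M (\<lambda>\<omega>. (X i \<omega>)\<^sup>2)" "\<And>i. expectation (X i) = 0"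
    and l: "l > 0"
  shows "prob {\<omega>\<in>space M. \<exists>m\<le>n. l \<le> \<bar>\<Sum>i<m. X i \<omega>\<bar>} \<le> (\<Sum>i<n. expectation (\<lambda>\<omega>. (X i \<omega>)\<^sup>2)) / l\<^sup>2"
proof -
  have [measurable]: "X i \<in> borel_measurable M" for i
    using ind by (auto simp: indep_vars_def)
  have S [measurable]: "(\<lambda>\<omega>. stopped l n (\<lambda>i. X i \<omega>)) \<in> borel_measurable M" for n
    by (rule measurable_stopped) auto
  have "prob {\<omega>\<in>space M. \<exists>m\<le>n. l \<le> \<bar>\<Sum>i<m. X i \<omega>\<bar>} \<le> prob {\<omega>\<in>space M. l\<^sup>2 \<le> (stopped l n (\<lambda>i. X i \<omega>))\<^sup>2}"
    using stopped_exceeds[OF l] l by (intro finite_measure_mono) (auto simp flip: abs_le_square_iff)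
  also have "\<dots> \<le> expectation (\<lambda>\<omega>. (stopped l n (\<lambda>i. X i \<omega>))\<^sup>2) / l\<^sup>2"
    using l by (intro integral_Markov_inequality_measure[where A = "{}"] integrable_stopped_square[OF ind X]) auto
  also have "\<dots> \<le> (\<Sum>i<n. expectation (\<lambda>\<omega>. (X i \<omega>)\<^sup>2)) / l\<^sup>2"
    by (intro divide_right_mono expectation_stopped_square[OF ind X]) auto
  finally show ?thesis .
qed

theorem kolmogorov_one_series:
  fixes X :: "nat \<Rightarrow> 'a \<Rightarrow> real"
  assumes ind: "indep_vars (\<lambda>_. borel) X (UNIV :: nat set)"
    and X: "\<And>i. integrable M (\<lambda>\<omega>. (X i \<omega>)\<^sup>2)" "\<And>i. expectation (X i) = 0"
    and sum: "summable (\<lambda>i. expectation (\<lambda>\<omega>. (X i \<omega>)\<^sup>2))"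
  shows "AE \<omega> in M. summable (\<lambda>i. X i \<omega>)"
proof -
  let ?v = "\<lambda>i. expectation (\<lambda>\<omega>. (X i \<omega>)\<^sup>2)"
  have [measurable]: "X i \<in> borel_measurable M" for i
    using ind by (auto simp: indep_vars_def)
  define osc where "osc l N = {\<omega>\<in>space M. \<exists>m. l \<le> \<bar>\<Sum>i<m. X (i + N) \<omega>\<bar>}" for l N
  have [measurable]: "osc l N \<in> events" for l N
    unfolding osc_def by measurable
  have osc: "prob (osc l N) \<le> (\<Sum>i. ?v (i + N)) / l\<^sup>2" if l: "l > 0" for l N
  proof -
    have ind': "indep_vars (\<lambda>_. borel) (\<lambda>i. X (i + N)) (UNIV :: nat set)"
      by (rule indep_vars_reindex[OF indep_vars_subset[OF ind]]) (auto simp: inj_def)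
    have sum': "summable (\<lambda>i. ?v (i + N))"
      using sum by (rule summable_ignore_initial_segment)
    let ?A = "\<lambda>n. {\<omega>\<in>space M. \<exists>m\<le>n. l \<le> \<bar>\<Sum>i<m. X (i + N) \<omega>\<bar>}"
    \<comment> \<open>Continuity from below passes from maxima over \<open>m \<le> n\<close> to the
      supremum over all \<open>m\<close>, with a bound independent of \<open>n\<close>.\<close>
    have "(\<lambda>n. prob (?A n)) \<longlonglongrightarrow> prob (\<Union>n. ?A n)"
      by (rule finite_Lim_measure_incseq) (auto simp: incseq_def, meson le_trans)
    moreover have "(\<Union>n. ?A n) = osc l N"
      by (auto simp: osc_def)
    moreover have "prob (?A n) \<le> (\<Sum>i. ?v (i + N)) / l\<^sup>2" for n
    proof -
      have "prob (?A n) \<le> (\<Sum>i<n. ?v (i + N)) / l\<^sup>2"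
        by (rule kolmogorov_inequality[OF ind' X(1) X(2) l])
      also have "\<dots> \<le> (\<Sum>i. ?v (i + N)) / l\<^sup>2"
        by (intro divide_right_mono sum_le_suminf sum') auto
      finally show ?thesis .
    qed
    ultimately show ?thesis
      by (intro LIMSEQ_le_const2) auto
  qed
  have tail: "(\<lambda>N. \<Sum>i. ?v (i + N)) \<longlonglongrightarrow> 0"
    using sum by (rule suminf_exist_split2)
  have "AE \<omega> in M. \<forall>j::nat. \<exists>N. \<omega> \<notin> osc (1 / (j + 1)) N"
    unfolding AE_all_countable
  proof
    fix j :: nat
    let ?l = "1 / (real j + 1)"
    \<comment> \<open>The intersection is bounded by every tail of the variance series, hence null.
      Countably many levels \<open>1 / (j + 1)\<close> suffice for the Cauchy criterion.\<close>
    have "prob (\<Inter>N. osc ?l N) \<le> (\<Sum>i. ?v (i + N)) / ?l\<^sup>2" for N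
      using osc[of ?l N] finite_measure_mono[of "\<Inter>N. osc ?l N" "osc ?l N"] by force
    moreover have "(\<lambda>N. (\<Sum>i. ?v (i + N)) / ?l\<^sup>2) \<longlonglongrightarrow> 0 / ?l\<^sup>2"
      by (intro tendsto_divide tail tendsto_const) auto
    ultimately have "prob (\<Inter>N. osc ?l N) \<le> 0 / ?l\<^sup>2"
      using LIMSEQ_le_const by blast
    then have "prob (\<Inter>N. osc ?l N) = 0"
      by (simp add: measure_le_0_iff)
    then have "(\<Inter>N. osc ?l N) \<in> null_sets M"
      by (auto simp: emeasure_eq_measure intro!: null_setsI)
    then show "AE \<omega> in M. \<exists>N. \<omega> \<notin> osc (1 / (real j + 1)) N"
      using AE_not_in by fastforce
  qed
  then show ?thesis
    using AE_space
  proof eventually_elim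
    case (elim \<omega>)
    show ?case
    proof -
      have "\<exists>N. \<forall>m\<ge>N. \<forall>n. norm (\<Sum>i=m..<n. X i \<omega>) < e" if "e > 0" for e
      proof -
        obtain j :: nat where j: "1 / (real j + 1) < e / 2"
          using \<open>e > 0\<close> by (metis half_gt_zero nat_approx_posE of_nat_Suc add.commute)
        obtain N where N: "\<omega> \<notin> osc (1 / (real j + 1)) N"
          using elim by blast
        \<comment> \<open>Blocks starting at \<open>N\<close> are below \<open>e / 2\<close>; an
          arbitrary later block is a difference of two of them.\<close>
        have *: "\<bar>\<Sum>i=N..<n. X i \<omega>\<bar> < e / 2" if "N \<le> n" for n
        proof -
          have "(\<Sum>i=N..<n. X i \<omega>) = (\<Sum>i<n - N. X (i + N) \<omega>)"
            using sum.shift_bounds_nat_ivl[of "\<lambda>i. X i \<omega>" 0 N "n - N"] that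
            by (simp add: atLeast0LessThan)
          then show ?thesis
            using N elim(2) j by (fastforce simp: osc_def not_le intro: less_trans simp del: less_divide_eq_numeral1)
        qed
        have "norm (\<Sum>i=m..<n. X i \<omega>) < e" if "N \<le> m" for m n
        proof (cases "m \<le> n")
          case True
          then have "(\<Sum>i=m..<n. X i \<omega>) = (\<Sum>i=N..<n. X i \<omega>) - (\<Sum>i=N..<m. X i \<omega>)"
            using sum_diff_nat_ivl[of N m n "\<lambda>i. X i \<omega>"] that by simp
          then show ?thesis
            using *[of m] *[of n] that True by (auto simp: abs_if split: if_splits)
        qed (use \<open>e > 0\<close> in auto)
        then show ?thesis by blast
      qed
      then show ?thesis
        unfolding summable_Cauchy by blast
    qed
  qed
qed

end

section \<open>Moments of the noise\<close>

lemma indep_vars_PiM: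
  assumes "\<And>i. prob_space (M i)"
  shows "prob_space.indep_vars (Pi\<^sub>M UNIV M) M (\<lambda>i \<omega>. \<omega> i) UNIV"
proof -
  interpret prob_space "Pi\<^sub>M UNIV M"
    using assms by (intro prob_space_PiM)
  have "distr (Pi\<^sub>M UNIV M) (M i) (\<lambda>\<omega>. \<omega> i) = M i" for i
    using assms by (intro distr_PiM_component) auto
  moreover have "distr (Pi\<^sub>M UNIV M) (Pi\<^sub>M UNIV M) (\<lambda>\<omega>. \<lambda>i\<in>UNIV. \<omega> i) = Pi\<^sub>M UNIV M"
    by (simp add: restrict_UNIV)
  ultimately show ?thesis
    by (subst indep_vars_iff_distr_eq_PiM) auto
qed

lemma (in finite_measure) integrable_mult_of_squares:
  fixes X Y :: "'a \<Rightarrow> real"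
  assumes [measurable]: "X \<in> borel_measurable M" "Y \<in> borel_measurable M"
    and "integrable M (\<lambda>\<omega>. (X \<omega>)\<^sup>2)" "integrable M (\<lambda>\<omega>. (Y \<omega>)\<^sup>2)"
  shows "integrable M (\<lambda>\<omega>. X \<omega> * Y \<omega>)"
proof (rule Bochner_Integration.integrable_bound)
  show "integrable M (\<lambda>\<omega>. (X \<omega>)\<^sup>2 + (Y \<omega>)\<^sup>2)"
    using assms by simp
  have "2 * \<bar>x * y\<bar> \<le> x\<^sup>2 + y\<^sup>2" for x y :: real
    using sum_squares_bound[of "\<bar>x\<bar>" "\<bar>y\<bar>"] by (simp add: abs_mult)
  then have "\<bar>x * y\<bar> \<le> x\<^sup>2 + y\<^sup>2" for x y :: real
    using abs_ge_zero[of "x * y"] by (smt (verit))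
  then show "AE \<omega> in M. norm (X \<omega> * Y \<omega>) \<le> norm ((X \<omega>)\<^sup>2 + (Y \<omega>)\<^sup>2)"
    by simp
qed simp

lemma (in finite_measure)
  fixes X :: "'i \<Rightarrow> 'a \<Rightarrow> real"
  assumes [measurable]: "\<And>i. X i \<in> borel_measurable M"
    and X: "\<And>i. integrable M (\<lambda>\<omega>. (X i \<omega>)\<^sup>2)" "\<And>i. (\<integral>\<omega>. (X i \<omega>)\<^sup>2 \<partial>M) = s"
    and orth: "\<And>i j. i \<noteq> j \<Longrightarrow> (\<integral>\<omega>. X i \<omega> * X j \<omega> \<partial>M) = 0"
  shows integrable_orthogonal_sum_square: "integrable M (\<lambda>\<omega>. (\<Sum>i\<in>J. c i * X i \<omega>)\<^sup>2)"
    and integral_orthogonal_sum_square: "(\<integral>\<omega>. (\<Sum>i\<in>J. c i * X i \<omega>)\<^sup>2 \<partial>M) = s * (\<Sum>i\<in>J. (c i)\<^sup>2)"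
proof -
  have int: "integrable M (\<lambda>\<omega>. X i \<omega> * X j \<omega>)" for i j
    by (intro integrable_mult_of_squares X) auto
  have eq: "(\<Sum>i\<in>J. c i * X i \<omega>)\<^sup>2 = (\<Sum>i\<in>J. \<Sum>j\<in>J. (c i * c j) * (X i \<omega> * X j \<omega>))" for \<omega>
    unfolding power2_eq_square sum_product by (intro sum.cong) auto
  show "integrable M (\<lambda>\<omega>. (\<Sum>i\<in>J. c i * X i \<omega>)\<^sup>2)"
    unfolding eq using int by (intro Bochner_Integration.integrable_sum integrable_mult_right)
  have "(\<integral>\<omega>. (\<Sum>i\<in>J. c i * X i \<omega>)\<^sup>2 \<partial>M) = (\<Sum>i\<in>J. \<Sum>j\<in>J. (c i * c j) * (\<integral>\<omega>. X i \<omega> * X j \<omega> \<partial>M))"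
    unfolding eq using int by (simp add: integral_sum)
  also have "\<dots> = (\<Sum>i\<in>J. \<Sum>j\<in>J. if i = j then c i * c i * s else 0)"
    using X(2) orth by (intro sum.cong refl) (auto simp: power2_eq_square)
  also have "\<dots> = s * (\<Sum>i\<in>J. (c i)\<^sup>2)"
    by (cases "finite J") (simp_all add: sum_distrib_left power2_eq_square mult_ac)
  finally show "(\<integral>\<omega>. (\<Sum>i\<in>J. c i * X i \<omega>)\<^sup>2 \<partial>M) = s * (\<Sum>i\<in>J. (c i)\<^sup>2)" .
qed

lemma borel_measurable_cart:
  fixes f :: "'a \<Rightarrow> real^'d::finite"
  assumes "\<And>i. (\<lambda>x. f x $ i) \<in> borel_measurable M"
  shows "f \<in> borel_measurable M"
  using assms by (subst borel_measurable_euclidean_space) (auto simp: Basis_vec_def inner_axis)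

text \<open>Noise enters the increments only as the discrete gradient of a scalar field. Since this
  gradient commutes with \<open>avg\<close>, averaging may act on the scalar noise.\<close>

definition grad :: "(int^'d::finite \<Rightarrow> real) \<Rightarrow> int^'d \<Rightarrow> real^'d" where
  "grad f x = (\<chi> i. f x - f (x - unitv i))"

lemma grad_nth [simp]: "grad f x $ i = f x - f (x - unitv i)"
  by (simp add: grad_def)

lemma avg_grad: "avg p t (grad f) x = grad (avg p t f) x"
  using avg_translate[of p t f "- unitv _" x]
  by (simp add: vec_eq_iff avg_nth avg_diff)

text \<open>The noise accumulated in \<open>s\<close> steps, with \<open>\<omega> k\<close> the
  slice of age \<open>k\<close>, averaged \<open>k\<close> times since it arrived. With this
  indexing the sums for different \<open>s\<close> are partial sums of one series, the one defining
  \<open>Delta0\<close>.\<close>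

definition pert :: "(int^'d::finite \<Rightarrow> real) \<Rightarrow> nat \<Rightarrow> (nat \<Rightarrow> int^'d \<Rightarrow> real) \<Rightarrow> int^'d \<Rightarrow> real^'d" where
  "pert p s \<omega> x = (\<Sum>k<s. grad (avg p k (\<omega> k)) x)"

lemma avg_pert: "avg p t (pert p s \<omega>) x = (\<Sum>k<s. grad (avg p (t + k) (\<omega> k)) x)"
  unfolding pert_def[abs_def] avg_sum avg_grad avg_avg ..

text \<open>Prepending the newest slice ages every other slice by one step, which is one more
  averaging.\<close>

lemma pert_Suc: "pert p (Suc s) (case_nat \<zeta> \<omega>) x = grad \<zeta> x + avg p 1 (pert p s \<omega>) x"
  unfolding avg_pert by (simp add: pert_def sum.lessThan_Suc_shift del: sum.lessThan_Suc)

lemma step_eq: "step p \<eta> \<zeta> x = avg p 1 \<eta> x + grad \<zeta> x"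
  by (simp add: vec_eq_iff step_def)

section \<open>Second moments of linear functionals of the space-time noise\<close>

locale incr_chain = rw_kernel p for p :: "int^'d::finite \<Rightarrow> real" +
  fixes \<mu> :: "real measure"
  assumes prob_mu: "prob_space \<mu>" and sets_mu [measurable_cong, simp]: "sets \<mu> = sets borel"
    and mean_zero: "(\<integral>s. s \<partial>\<mu>) = 0" and square_integrable: "integrable \<mu> (\<lambda>s. s\<^sup>2)"
begin

abbreviation slice :: "(int^'d \<Rightarrow> real) measure" where "slice \<equiv> noise_slice \<mu>"
abbreviation past :: "(nat \<Rightarrow> int^'d \<Rightarrow> real) measure" where "past \<equiv> past_noise \<mu>"

lemma prob_slice: "prob_space slice"
  by (intro prob_space_PiM prob_mu)

lemma prob_past: "prob_space past"
  by (intro prob_space_PiM prob_slice)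

definition var :: real where "var = (\<integral>s. s\<^sup>2 \<partial>\<mu>)"

lemma var_nonneg: "0 \<le> var"
  by (simp add: var_def)

lemma distr_slice: "distr past slice (\<lambda>\<omega>. \<omega> k) = slice"
  using prob_slice by (intro distr_PiM_component) auto

lemma distr_site: "distr slice \<mu> (\<lambda>x. x z) = \<mu>"
  using prob_mu by (intro distr_PiM_component) auto

lemma measurable_slice: "(\<lambda>x. x z) \<in> borel_measurable slice"
  using measurable_component_singleton[of z UNIV "\<lambda>_. \<mu>"] by (simp cong: measurable_cong_sets)

lemma measurable_past_slice: "(\<lambda>\<omega>. \<omega> k) \<in> past \<rightarrow>\<^sub>M slice"
  by (rule measurable_component_singleton) auto

lemma measurable_noise: "(\<lambda>\<omega>. \<omega> k z) \<in> borel_measurable past"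
  using measurable_compose[OF measurable_past_slice measurable_slice] .

lemma measurable_avg_noise [measurable]: "(\<lambda>\<omega>. avg p t (\<omega> k) x) \<in> borel_measurable past"
  by (intro measurable_avg measurable_noise)

lemma measurable_pert [measurable]: "(\<lambda>\<omega>. pert p s \<omega> x) \<in> borel_measurable past"
  using measurable_avg_noise
  by (intro borel_measurable_cart) (auto simp: pert_def intro!: borel_measurable_sum borel_measurable_diff)

lemma
  fixes f :: "real \<Rightarrow> real"
  assumes [measurable]: "f \<in> borel_measurable borel"
  shows integrable_noise_iff: "integrable past (\<lambda>\<omega>. f (\<omega> k z)) \<longleftrightarrow> integrable \<mu> f"
    and integral_noise: "(\<integral>\<omega>. f (\<omega> k z) \<partial>past) = (\<integral>s. f s \<partial>\<mu>)"
proof -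
  have [measurable]: "(\<lambda>x. x z) \<in> slice \<rightarrow>\<^sub>M \<mu>"
    by (rule measurable_component_singleton) auto
  have *: "(\<lambda>x. f (x z)) \<in> borel_measurable slice"
    by (rule measurable_compose[OF measurable_slice assms])
  have "integrable past (\<lambda>\<omega>. f (\<omega> k z)) \<longleftrightarrow> integrable (distr past slice (\<lambda>\<omega>. \<omega> k)) (\<lambda>x. f (x z))"
    by (rule integrable_distr_eq[OF measurable_past_slice *, symmetric])
  also have "\<dots> \<longleftrightarrow> integrable (distr slice \<mu> (\<lambda>x. x z)) f"
    unfolding distr_slice by (rule integrable_distr_eq[symmetric]) (simp_all cong: measurable_cong_sets)
  finally show "integrable past (\<lambda>\<omega>. f (\<omega> k z)) \<longleftrightarrow> integrable \<mu> f"
    unfolding distr_site .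
  have "(\<integral>\<omega>. f (\<omega> k z) \<partial>past) = (\<integral>x. f (x z) \<partial>distr past slice (\<lambda>\<omega>. \<omega> k))"
    by (rule integral_distr[OF measurable_past_slice *, symmetric])
  also have "\<dots> = (\<integral>s. f s \<partial>distr slice \<mu> (\<lambda>x. x z))"
    unfolding distr_slice by (rule integral_distr[symmetric]) (simp_all cong: measurable_cong_sets)
  finally show "(\<integral>\<omega>. f (\<omega> k z) \<partial>past) = (\<integral>s. f s \<partial>\<mu>)"
    unfolding distr_site .
qed

lemma integrable_mu: "integrable \<mu> (\<lambda>s. s)"
proof -
  interpret prob_space \<mu> by (rule prob_mu)
  show ?thesis
    by (rule square_integrable_imp_integrable[OF _ square_integrable]) simp
qed

lemma noise_moments:
  "integrable past (\<lambda>\<omega>. \<omega> k z)" "(\<integral>\<omega>. \<omega> k z \<partial>past) = 0"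
  "integrable past (\<lambda>\<omega>. (\<omega> k z)\<^sup>2)" "(\<integral>\<omega>. (\<omega> k z)\<^sup>2 \<partial>past) = var"
  using integrable_noise_iff[of "\<lambda>s. s" k z] integrable_noise_iff[of "\<lambda>s. s\<^sup>2" k z]
    integral_noise[of "\<lambda>s. s" k z] integral_noise[of "\<lambda>s. s\<^sup>2" k z]
  by (simp_all add: integrable_mu mean_zero square_integrable var_def)

lemma indep_past: "prob_space.indep_vars past (\<lambda>_. slice) (\<lambda>k \<omega>. \<omega> k) UNIV"
  using prob_slice by (intro indep_vars_PiM) auto

lemma noise_orthogonal:
  assumes "(k, z) \<noteq> (k', z')"
  shows "(\<integral>\<omega>. \<omega> k z * \<omega> k' z' \<partial>past) = 0"
proof (cases "k = k'")
  case True
  interpret prob_space slice by (rule prob_slice)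
  have "z \<noteq> z'"
    using assms True by auto
  have int: "integrable slice (\<lambda>x. x z)" for z
    using integrable_distr_eq[OF measurable_past_slice[of 0] measurable_slice[of z]] noise_moments(1)[of 0 z]
    by (simp add: distr_slice)
  have zero: "(\<integral>x. x z \<partial>slice) = 0" for z
    using integral_distr[OF measurable_past_slice[of 0] measurable_slice[of z]] noise_moments(2)[of 0 z]
    by (simp add: distr_slice)
  have "indep_vars (\<lambda>_. \<mu>) (\<lambda>z x. x z) UNIV"
    using prob_mu by (intro indep_vars_PiM) auto
  then have "indep_vars (\<lambda>_. borel) (\<lambda>z x. x z) UNIV"
    by (rule indep_vars_compose2[where Y = "\<lambda>_ s. s"]) (simp cong: measurable_cong_sets)
  then have "indep_vars (\<lambda>_. borel) (\<lambda>z x. x z) (insert z {z'})"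
    by (rule indep_vars_subset) auto
  \<comment> \<open>A sum over the singleton \<open>{z'}\<close> reduces joint independence to that
    of a pair.\<close>
  from indep_vars_sum[OF _ _ this] \<open>z \<noteq> z'\<close>
  have "indep_var borel (\<lambda>x. x z) borel (\<lambda>x. x z')"
    by simp
  then have "(\<integral>x. x z * x z' \<partial>slice) = 0"
    by (simp add: indep_var_lebesgue_integral int zero)
  moreover have "(\<integral>\<omega>. \<omega> k z * \<omega> k' z' \<partial>past) = (\<integral>x. x z * x z' \<partial>distr past slice (\<lambda>\<omega>. \<omega> k))"
    unfolding True using measurable_slice
    by (intro integral_distr[OF measurable_past_slice, symmetric]) simp
  ultimately show ?thesis
    by (simp add: distr_slice)
next
  case False
  interpret prob_space past by (rule prob_past)
  \<comment> \<open>One coordinate of each slice is retained, \<open>z\<close> from slice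
    \<open>k\<close> and \<open>z'\<close> from all others, so that independence of whole slices
    applies.\<close>
  have "indep_vars (\<lambda>_. borel) (\<lambda>l \<omega>. \<omega> l (if l = k then z else z')) UNIV"
    by (rule indep_vars_compose2[OF indep_past, where Y = "\<lambda>l x. x (if l = k then z else z')"])
      (rule measurable_slice)
  then have "indep_vars (\<lambda>_. borel) (\<lambda>l \<omega>. \<omega> l (if l = k then z else z')) (insert k {k'})"
    by (rule indep_vars_subset) auto
  from indep_vars_sum[OF _ _ this] False
  have "indep_var borel (\<lambda>\<omega>. \<omega> k z) borel (\<lambda>\<omega>. \<omega> k' z')"
    by simp
  then show ?thesis
    by (simp add: indep_var_lebesgue_integral noise_moments)
qed

text \<open>The noise variables over space-time are orthogonal with common second moment
  \<open>var\<close>, so squared norms reduce to sums of squared coefficients over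
  \<open>Sigma K B\<close>.\<close>

lemma
  assumes "\<And>k. finite (B k)"
  shows integrable_noise_sum_square: "integrable past (\<lambda>\<omega>. (\<Sum>k\<in>K. \<Sum>z\<in>B k. c k z * \<omega> k z)\<^sup>2)"
    and integral_noise_sum_square: "(\<integral>\<omega>. (\<Sum>k\<in>K. \<Sum>z\<in>B k. c k z * \<omega> k z)\<^sup>2 \<partial>past)
      = var * (\<Sum>k\<in>K. \<Sum>z\<in>B k. (c k z)\<^sup>2)"
proof -
  interpret prob_space past by (rule prob_past)
  let ?X = "\<lambda>(k, z) \<omega>. \<omega> k z :: real"
  have X: "\<And>i. ?X i \<in> borel_measurable past" "\<And>i. integrable past (\<lambda>\<omega>. (?X i \<omega>)\<^sup>2)"
      "\<And>i. (\<integral>\<omega>. (?X i \<omega>)\<^sup>2 \<partial>past) = var" "\<And>i j. i \<noteq> j \<Longrightarrow> (\<integral>\<omega>. ?X i \<omega> * ?X j \<omega> \<partial>past) = 0"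
    using measurable_noise noise_moments(3,4) noise_orthogonal by (simp_all add: split_beta prod_eq_iff)
  have *: "(\<Sum>k\<in>K. \<Sum>z\<in>B k. h k z) = (\<Sum>i\<in>Sigma K B. h (fst i) (snd i))" if "finite K" for h :: "nat \<Rightarrow> int^'d \<Rightarrow> real"
    using assms that by (simp add: sum.Sigma case_prod_beta)
  show "integrable past (\<lambda>\<omega>. (\<Sum>k\<in>K. \<Sum>z\<in>B k. c k z * \<omega> k z)\<^sup>2)"
    using integrable_orthogonal_sum_square[OF X, where c = "\<lambda>i. c (fst i) (snd i)" and J = "Sigma K B"]
    by (cases "finite K") (simp_all add: * case_prod_beta)
  show "(\<integral>\<omega>. (\<Sum>k\<in>K. \<Sum>z\<in>B k. c k z * \<omega> k z)\<^sup>2 \<partial>past) = var * (\<Sum>k\<in>K. \<Sum>z\<in>B k. (c k z)\<^sup>2)"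
    using integral_orthogonal_sum_square[OF X, where c = "\<lambda>i. c (fst i) (snd i)" and J = "Sigma K B"]
    by (cases "finite K") (simp_all add: * case_prod_beta)
qed

end

section \<open>The stationary perturbation and the evolution\<close>

lemma (in prob_space) expectation_abs_le_sqrt:
  fixes X :: "'a \<Rightarrow> real"
  assumes [measurable]: "X \<in> borel_measurable M" and "integrable M (\<lambda>\<omega>. (X \<omega>)\<^sup>2)"
  shows "expectation (\<lambda>\<omega>. \<bar>X \<omega>\<bar>) \<le> sqrt (expectation (\<lambda>\<omega>. (X \<omega>)\<^sup>2))"
proof -
  have X: "integrable M (\<lambda>\<omega>. \<bar>X \<omega>\<bar>)"
    using square_integrable_imp_integrable[OF assms] by simp
  have "0 \<le> variance (\<lambda>\<omega>. \<bar>X \<omega>\<bar>)"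
    by (rule variance_positive)
  also have "\<dots> = expectation (\<lambda>\<omega>. (X \<omega>)\<^sup>2) - (expectation (\<lambda>\<omega>. \<bar>X \<omega>\<bar>))\<^sup>2"
    using assms X by (subst variance_eq) auto
  finally show ?thesis
    by (intro real_le_rsqrt) simp
qed

lemma nn_integral_distr':
  "T \<in> M \<rightarrow>\<^sub>M M' \<Longrightarrow> f \<in> borel_measurable M' \<Longrightarrow> integral\<^sup>N (distr M M' T) f = (\<integral>\<^sup>+ x. f (T x) \<partial>M)"
  by (rule nn_integral_distr) simp_all

lemma measurable_UNIV_PiM:
  assumes "\<And>x. (\<lambda>\<omega>. f \<omega> x) \<in> borel_measurable M"
  shows "f \<in> M \<rightarrow>\<^sub>M Pi\<^sub>M UNIV (\<lambda>_. borel)"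
  using measurable_PiM_single'[of UNIV "\<lambda>x \<omega>. f \<omega> x" M "\<lambda>_. borel"] assms by auto

lemma integrable_vec:
  fixes f :: "'a \<Rightarrow> real^'d::finite"
  assumes "\<And>i. integrable M (\<lambda>\<omega>. f \<omega> $ i)"
  shows "integrable M f"
proof -
  have "integrable M (\<lambda>\<omega>. \<Sum>i\<in>UNIV. (f \<omega> $ i) *\<^sub>R axis i (1::real))"
    using assms by (intro Bochner_Integration.integrable_sum integrable_scaleR_left) auto
  moreover have "(\<Sum>i\<in>UNIV. (f \<omega> $ i) *\<^sub>R axis i 1) = f \<omega>" for \<omega>
    using basis_expansion[of "f \<omega>"] by (simp add: scalar_mult_eq_scaleR)
  ultimately show ?thesis by simp
qed

context rw_kernel
begin

definition touched :: "nat \<Rightarrow> int^'d \<Rightarrow> 'd \<Rightarrow> (int^'d) set" where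
  "touched k x i = {z. pk p k (z - x) \<noteq> 0 \<or> pk p k (z - (x - unitv i)) \<noteq> 0}"

lemma finite_touched [simp]: "finite (touched k x i)"
proof -
  have "touched k x i = {z. pk p k (z - x) \<noteq> 0} \<union> {z. pk p k (z - (x - unitv i)) \<noteq> 0}"
    by (auto simp: touched_def)
  then show ?thesis
    by (simp only: finite_Un finite_pk)
qed

lemma grad_avg_eq_sum:
  "grad (avg p k f) x $ i = (\<Sum>z\<in>touched k x i. (pk p k (z - x) - pk p k (z - (x - unitv i))) * f z)"
  unfolding grad_nth
  by (subst avg_diff_eq_sum[OF finite_touched[of k x i]]) (auto simp: touched_def)

text \<open>Squared coefficient norm of the noise slice of age \<open>k\<close> in component
  \<open>i\<close> of the increment, the same at every site. The base point 0 and the displacement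
  \<open>- unitv i\<close> fit \<open>pk_l2_difference\<close>.\<close>

definition roughness :: "'d \<Rightarrow> nat \<Rightarrow> real" where
  "roughness i k = (\<Sum>z\<in>touched k 0 i. (pk p k (z - - unitv i) - pk p k z)\<^sup>2)"

lemma roughness_translate:
  "(\<Sum>z\<in>touched k x i. (pk p k (z - x) - pk p k (z - (x - unitv i)))\<^sup>2) = roughness i k"
proof -
  have "touched k x i = (\<lambda>z. z + x) ` touched k 0 i"
  proof (intro equalityI subsetI)
    fix z assume "z \<in> touched k x i"
    then show "z \<in> (\<lambda>z. z + x) ` touched k 0 i"
      by (intro image_eqI[of _ _ "z - x"]) (auto simp: touched_def algebra_simps)
  qed (auto simp: touched_def algebra_simps)
  then show ?thesis
    unfolding roughness_def
    by (simp add: sum.reindex algebra_simps power2_commute[of "pk p k _" "pk p k (_ + unitv i)"])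
qed

lemma roughness_nonneg: "0 \<le> roughness i k"
  by (simp add: roughness_def sum_nonneg)

lemma summable_roughness: "summable (roughness i)"
proof -
  obtain C where C: "\<And>n B. (\<forall>k. finite (B k)) \<Longrightarrow>
      (\<Sum>k<n. \<Sum>z\<in>B k. (pk p k (z - - unitv i) - pk p k z)\<^sup>2) \<le> C"
    using pk_l2_difference[of "- unitv i"] by blast
  show ?thesis
  proof (rule summableI_nonneg_bounded)
    show "(\<Sum>k<n. roughness i k) \<le> C" for n
      unfolding roughness_def by (rule C) simp
  qed (rule roughness_nonneg)
qed

end

section \<open>Moments and almost sure limit of the accumulated noise\<close>

context incr_chain
begin

lemma avg_pert_nth:
  "avg p t (pert p s \<omega>) x $ i = (\<Sum>k<s. \<Sum>z\<in>touched (t + k) x i.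
    (pk p (t + k) (z - x) - pk p (t + k) (z - (x - unitv i))) * \<omega> k z)"
  unfolding avg_pert sum_component grad_avg_eq_sum ..

text \<open>Averaging \<open>t\<close> more times turns age \<open>k\<close> into age
  \<open>t + k\<close>, so the second moment is a block of the summable series
  \<open>roughness i\<close>, starting at \<open>t\<close>.\<close>

lemma
  shows integrable_avg_pert_square: "integrable past (\<lambda>\<omega>. (avg p t (pert p s \<omega>) x $ i)\<^sup>2)"
    and integral_avg_pert_square:
      "(\<integral>\<omega>. (avg p t (pert p s \<omega>) x $ i)\<^sup>2 \<partial>past) = var * (\<Sum>k<s. roughness i (t + k))"
  unfolding avg_pert_nth
  by (simp_all only: integrable_noise_sum_square integral_noise_sum_square finite_touched roughness_translate)

lemma
  shows integrable_grad_avg_square: "integrable past (\<lambda>\<omega>. (grad (avg p k (\<omega> k)) x $ i)\<^sup>2)"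
    and integral_grad_avg_square: "(\<integral>\<omega>. (grad (avg p k (\<omega> k)) x $ i)\<^sup>2 \<partial>past) = var * roughness i k"
  using integrable_noise_sum_square[of "\<lambda>k. touched k x i" "\<lambda>k z. pk p k (z - x) - pk p k (z - (x - unitv i))" "{k}"]
    integral_noise_sum_square[of "\<lambda>k. touched k x i" "\<lambda>k z. pk p k (z - x) - pk p k (z - (x - unitv i))" "{k}"]
  unfolding grad_avg_eq_sum roughness_translate by (simp_all add: roughness_translate)

lemma integrable_grad_avg: "integrable past (\<lambda>\<omega>. grad (avg p k (\<omega> l)) x $ i)"
  unfolding grad_avg_eq_sum by (intro Bochner_Integration.integrable_sum integrable_mult_right noise_moments)

lemma integral_grad_avg: "(\<integral>\<omega>. grad (avg p k (\<omega> l)) x $ i \<partial>past) = 0"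
  unfolding grad_avg_eq_sum
  by (subst Bochner_Integration.integral_sum) (auto intro!: noise_moments sum.neutral simp: noise_moments)

text \<open>Bound for the mean norm of the averaged noise: the Euclidean norm is at most the sum of
  absolute components, each controlled by its second moment. Taking the whole tail makes it uniform
  in \<open>s\<close>.\<close>

definition remainder :: "nat \<Rightarrow> real" where
  "remainder t = (\<Sum>i\<in>UNIV. sqrt (var * (\<Sum>k. roughness i (k + t))))"

lemma remainder_tendsto: "remainder \<longlonglongrightarrow> 0"
proof -
  have "(\<lambda>t. \<Sum>i\<in>UNIV. sqrt (var * (\<Sum>k. roughness i (k + t)))) \<longlonglongrightarrow> (\<Sum>i\<in>(UNIV :: 'd set). sqrt (var * 0))"
    by (intro tendsto_sum tendsto_real_sqrt tendsto_mult tendsto_const suminf_exist_split2 summable_roughness)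
  then show ?thesis
    by (simp add: remainder_def[abs_def])
qed

lemma integrable_pert: "integrable past (\<lambda>\<omega>. pert p s \<omega> x)"
  unfolding pert_def by (intro integrable_vec) (auto intro!: integrable_grad_avg simp del: grad_nth)

lemma integral_pert: "(\<integral>\<omega>. pert p s \<omega> x \<partial>past) = 0"
proof -
  have "(\<integral>\<omega>. pert p s \<omega> x \<partial>past) $ i = (\<integral>\<omega>. pert p s \<omega> x $ i \<partial>past)" for i
    by (rule integral_bounded_linear[OF bounded_linear_vec_nth integrable_pert, symmetric])
  moreover have "(\<integral>\<omega>. pert p s \<omega> x $ i \<partial>past) = 0" for i
    unfolding pert_def sum_component
    by (subst Bochner_Integration.integral_sum) (simp_all only: integrable_grad_avg integral_grad_avg sum.neutral_const)
  ultimately show ?thesis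
    by (simp add: vec_eq_iff)
qed

lemma integrable_avg_pert: "integrable past (\<lambda>\<omega>. avg p t (pert p s \<omega>) x)"
  by (intro integrable_avg integrable_pert)

lemma integral_norm_avg_pert: "(\<integral>\<omega>. norm (avg p t (pert p s \<omega>) x) \<partial>past) \<le> remainder t"
proof -
  interpret prob_space past by (rule prob_past)
  have int: "integrable past (\<lambda>\<omega>. avg p t (pert p s \<omega>) x $ i)" for i
    by (intro integrable_bounded_linear[OF bounded_linear_vec_nth] integrable_avg_pert)
  have "(\<integral>\<omega>. norm (avg p t (pert p s \<omega>) x) \<partial>past) \<le> (\<integral>\<omega>. (\<Sum>i\<in>UNIV. \<bar>avg p t (pert p s \<omega>) x $ i\<bar>) \<partial>past)"
    by (intro integral_mono integrable_norm integrable_avg_pert Bochner_Integration.integrable_sum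
        integrable_abs int norm_le_l1_cart)
  also have "\<dots> = (\<Sum>i\<in>UNIV. (\<integral>\<omega>. \<bar>avg p t (pert p s \<omega>) x $ i\<bar> \<partial>past))"
    by (intro Bochner_Integration.integral_sum integrable_abs int)
  also have "\<dots> \<le> remainder t"
    unfolding remainder_def
  proof (rule sum_mono)
    fix i
    have "(\<integral>\<omega>. \<bar>avg p t (pert p s \<omega>) x $ i\<bar> \<partial>past) \<le> sqrt (var * (\<Sum>k<s. roughness i (t + k)))"
      using expectation_abs_le_sqrt[OF borel_measurable_integrable[OF int] integrable_avg_pert_square]
      unfolding integral_avg_pert_square .
    also have "(\<Sum>k<s. roughness i (t + k)) \<le> (\<Sum>k. roughness i (k + t))"
      unfolding add.commute[of t]
      by (intro sum_le_suminf summable_ignore_initial_segment summable_roughness) (auto simp: roughness_nonneg)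
    finally show "(\<integral>\<omega>. \<bar>avg p t (pert p s \<omega>) x $ i\<bar> \<partial>past) \<le> sqrt (var * (\<Sum>k. roughness i (k + t)))"
      by (simp add: mult_left_mono var_nonneg)
  qed
  finally show ?thesis .
qed

lemma Delta0_nth: "Delta0 p \<omega> x $ i =
  (if summable (\<lambda>k. grad (avg p k (\<omega> k)) x $ i) then (\<Sum>k. grad (avg p k (\<omega> k)) x $ i) else 0)"
  unfolding grad_avg_eq_sum touched_def by (simp add: Delta0_def mult.commute)

text \<open>Terms of different age use different slices, hence are independent and centred, with
  variances \<open>var * roughness i k\<close>. Countability of sites and components leaves one null
  set, outside which the default 0 in \<open>Delta0\<close> never occurs.\<close>

lemma AE_pert_tendsto: "AE \<omega> in past. \<forall>x. (\<lambda>s. pert p s \<omega> x) \<longlonglongrightarrow> Delta0 p \<omega> x"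
proof -
  interpret prob_space past by (rule prob_past)
  have "AE \<omega> in past. summable (\<lambda>k. grad (avg p k (\<omega> k)) x $ i)" for x i
  proof (rule kolmogorov_one_series)
    have "(\<lambda>\<zeta>. grad (avg p k \<zeta>) x $ i) \<in> borel_measurable slice" for k
      using measurable_slice by (auto intro!: borel_measurable_diff measurable_avg)
    then show "indep_vars (\<lambda>_. borel) (\<lambda>k \<omega>. grad (avg p k (\<omega> k)) x $ i) UNIV"
      by (rule indep_vars_compose2[OF indep_past])
    show "summable (\<lambda>k. \<integral>\<omega>. (grad (avg p k (\<omega> k)) x $ i)\<^sup>2 \<partial>past)"
      unfolding integral_grad_avg_square by (intro summable_mult summable_roughness)
  qed (rule integrable_grad_avg_square integral_grad_avg)+
  then have "AE \<omega> in past. \<forall>x i. summable (\<lambda>k. grad (avg p k (\<omega> k)) x $ i)"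
    by (simp only: AE_all_countable) blast
  then show ?thesis
  proof eventually_elim
    case (elim \<omega>)
    show ?case
    proof (intro allI vec_tendstoI)
      fix x i
      show "(\<lambda>s. pert p s \<omega> x $ i) \<longlonglongrightarrow> Delta0 p \<omega> x $ i"
        using summable_LIMSEQ[OF elim[rule_format, of x i]] elim
        unfolding Delta0_nth pert_def sum_component by simp
    qed
  qed
qed

lemma measurable_Delta0: "(\<lambda>\<omega>. Delta0 p \<omega> x) \<in> borel_measurable past"
proof (rule borel_measurable_cart)
  fix i
  have [measurable]: "(\<lambda>\<omega>. grad (avg p k (\<omega> k)) x $ i) \<in> borel_measurable past" for k
    using measurable_avg_noise by auto
  show "(\<lambda>\<omega>. Delta0 p \<omega> x $ i) \<in> borel_measurable past"
    \<comment> \<open>In Cauchy form the convergence event is visibly measurable.\<close>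
    unfolding Delta0_nth summable_iff_convergent Cauchy_convergent_iff[symmetric]
    by (intro measurable_If sets_Collect_Cauchy borel_measurable_suminf) measurable
qed

end

text \<open>The state after \<open>t\<close> steps from \<open>\<eta>\<close>, where
  \<open>\<omega> 0\<close> is the noise of the last step.\<close>

definition evolve :: "(int^'d::finite \<Rightarrow> real) \<Rightarrow> nat \<Rightarrow> (int^'d \<Rightarrow> real^'d) \<Rightarrow> (nat \<Rightarrow> int^'d \<Rightarrow> real) \<Rightarrow> int^'d \<Rightarrow> real^'d" where
  "evolve p t \<eta> \<omega> x = avg p t \<eta> x + pert p t \<omega> x"

lemma evolve_Suc: "evolve p (Suc t) \<eta> (case_nat \<zeta> \<omega>) = step p (evolve p t \<eta> \<omega>) \<zeta>"
  unfolding fun_eq_iff step_eq evolve_def[abs_def] avg_add pert_Suc avg_avg by simp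

locale stationary_chain = incr_chain p \<mu> for p :: "int^'d::finite \<Rightarrow> real" and \<mu> +
  fixes \<nu> :: "(int^'d \<Rightarrow> real^'d) measure"
  assumes inv: "invariant p \<mu> \<nu>"
begin

lemma prob_nu: "prob_space \<nu>" and sets_nu [measurable_cong]: "sets \<nu> = sets CS"
  and distr_step: "distr (\<nu> \<Otimes>\<^sub>M slice) CS (\<lambda>(\<eta>, \<zeta>). step p \<eta> \<zeta>) = \<nu>"
  using inv by (auto simp: invariant_def)

lemma measurable_eta: "(\<lambda>\<eta>. \<eta> x) \<in> borel_measurable \<nu>"
  using measurable_component_singleton[of x UNIV "\<lambda>_. borel"] by (simp cong: measurable_cong_sets add: sets_nu)

lemma measurable_step: "(\<lambda>(\<eta>, \<zeta>). step p \<eta> \<zeta>) \<in> \<nu> \<Otimes>\<^sub>M slice \<rightarrow>\<^sub>M CS"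
proof (rule measurable_UNIV_PiM)
  fix x
  have "(\<lambda>y. fst y x) \<in> borel_measurable (\<nu> \<Otimes>\<^sub>M slice)" "(\<lambda>y. snd y x) \<in> borel_measurable (\<nu> \<Otimes>\<^sub>M slice)" for x
    by (rule measurable_compose[OF measurable_fst measurable_eta] measurable_compose[OF measurable_snd measurable_slice])+
  then show "(\<lambda>y. (case y of (\<eta>, \<zeta>) \<Rightarrow> step p \<eta> \<zeta>) x) \<in> borel_measurable (\<nu> \<Otimes>\<^sub>M slice)"
    unfolding split_beta step_eq
    by (intro borel_measurable_add measurable_avg) (auto intro!: borel_measurable_cart borel_measurable_diff)
qed

lemma measurable_evolve: "(\<lambda>(\<eta>, \<omega>). evolve p t \<eta> \<omega>) \<in> \<nu> \<Otimes>\<^sub>M past \<rightarrow>\<^sub>M CS"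
proof (rule measurable_UNIV_PiM)
  fix x
  have "(\<lambda>y. fst y x) \<in> borel_measurable (\<nu> \<Otimes>\<^sub>M past)" for x
    by (rule measurable_compose[OF measurable_fst measurable_eta])
  then show "(\<lambda>y. (case y of (\<eta>, \<omega>) \<Rightarrow> evolve p t \<eta> \<omega>) x) \<in> borel_measurable (\<nu> \<Otimes>\<^sub>M past)"
    unfolding split_beta evolve_def
    by (intro borel_measurable_add measurable_avg measurable_compose[OF measurable_snd measurable_pert])
qed

text \<open>The newest slice is split off the past; the older noise carries \<open>\<eta>\<close>
  through \<open>t\<close> steps, preserving the law by induction, and the split-off slice performs
  one invariant step.\<close>

lemma distr_evolve: "distr (\<nu> \<Otimes>\<^sub>M past) CS (\<lambda>(\<eta>, \<omega>). evolve p t \<eta> \<omega>) = \<nu>"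
proof (induction t)
  case 0
  interpret past: prob_space past by (rule prob_past)
  have "distr (\<nu> \<Otimes>\<^sub>M past) CS (\<lambda>(\<eta>, \<omega>). evolve p 0 \<eta> \<omega>) = distr (\<nu> \<Otimes>\<^sub>M past) \<nu> fst"
    by (intro distr_cong) (auto simp: sets_nu evolve_def pert_def)
  then show ?case
    using past.distr_pair_fst by simp
next
  case (Suc t)
  interpret nu: prob_space \<nu> by (rule prob_nu)
  interpret sl: prob_space slice by (rule prob_slice)
  interpret past: prob_space past by (rule prob_past)
  interpret seq: sequence_space slice
    by unfold_locales
  interpret sp: pair_sigma_finite slice past by unfold_locales
  show ?case
  proof (rule measure_eqI)
    fix A assume "A \<in> sets (distr (\<nu> \<Otimes>\<^sub>M past) CS (\<lambda>(\<eta>, \<omega>). evolve p (Suc t) \<eta> \<omega>))"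
    then have A [measurable]: "A \<in> sets CS" by simp
    define f where "f = (indicator A :: _ \<Rightarrow> ennreal)"
    have f [measurable]: "f \<in> borel_measurable CS"
      unfolding f_def by measurable
    note [measurable] = measurable_step measurable_evolve
    have step': "(\<lambda>y. step p (fst y) (snd y)) \<in> CS \<Otimes>\<^sub>M slice \<rightarrow>\<^sub>M CS"
      using measurable_step by (simp add: split_beta' cong: measurable_cong_sets)
    have ev: "(\<lambda>\<omega>. evolve p s \<eta> \<omega>) \<in> past \<rightarrow>\<^sub>M CS" for s \<eta>
      using measurable_compose[OF measurable_Pair1' measurable_evolve[of s]]
      by (simp add: sets_eq_imp_space_eq[OF sets_nu] space_PiM)
    have "emeasure (distr (\<nu> \<Otimes>\<^sub>M past) CS (\<lambda>(\<eta>, \<omega>). evolve p (Suc t) \<eta> \<omega>)) A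
        = (\<integral>\<^sup>+ y. f (evolve p (Suc t) (fst y) (snd y)) \<partial>(\<nu> \<Otimes>\<^sub>M past))"
      using nn_integral_distr'[OF measurable_evolve f, of "Suc t"] A
      by (simp add: f_def split_beta' flip: nn_integral_indicator)
    also have "\<dots> = (\<integral>\<^sup>+ \<eta>. \<integral>\<^sup>+ \<omega>. f (evolve p (Suc t) \<eta> \<omega>) \<partial>past \<partial>\<nu>)"
      using measurable_evolve[of "Suc t"]
      by (subst past.nn_integral_fst[symmetric]) (auto simp: split_beta' intro: measurable_compose[OF _ f])
    also have "\<dots> = (\<integral>\<^sup>+ \<eta>. \<integral>\<^sup>+ \<zeta>. \<integral>\<^sup>+ \<omega>. f (step p (evolve p t \<eta> \<omega>) \<zeta>) \<partial>past \<partial>slice \<partial>\<nu>)"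
    proof (rule nn_integral_cong)
      fix \<eta>
      have m: "(\<lambda>(\<zeta>, \<omega>). case_nat \<zeta> \<omega>) \<in> slice \<Otimes>\<^sub>M past \<rightarrow>\<^sub>M past"
        unfolding split_beta' by (rule measurable_case_nat'[OF measurable_fst measurable_snd])
      have "(\<integral>\<^sup>+ \<omega>. f (evolve p (Suc t) \<eta> \<omega>) \<partial>past)
          = (\<integral>\<^sup>+ \<omega>. f (evolve p (Suc t) \<eta> \<omega>) \<partial>distr (slice \<Otimes>\<^sub>M past) past (\<lambda>(\<zeta>, \<omega>). case_nat \<zeta> \<omega>))"
        \<comment> \<open>Prepending an independent slice to the past reproduces the law of the
          past.\<close>
        by (simp only: seq.PiM_iter)
      also have "\<dots> = (\<integral>\<^sup>+ y. f (evolve p (Suc t) \<eta> (case_nat (fst y) (snd y))) \<partial>(slice \<Otimes>\<^sub>M past))"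
        by (subst nn_integral_distr'[OF m measurable_compose[OF ev f]]) (simp add: split_beta')
      also have "\<dots> = (\<integral>\<^sup>+ \<zeta>. \<integral>\<^sup>+ \<omega>. f (evolve p (Suc t) \<eta> (case_nat \<zeta> \<omega>)) \<partial>past \<partial>slice)"
        using measurable_compose[OF m measurable_compose[OF ev f]]
        by (subst past.nn_integral_fst[symmetric]) (auto simp: split_beta')
      finally show "(\<integral>\<^sup>+ \<omega>. f (evolve p (Suc t) \<eta> \<omega>) \<partial>past)
          = (\<integral>\<^sup>+ \<zeta>. \<integral>\<^sup>+ \<omega>. f (step p (evolve p t \<eta> \<omega>) \<zeta>) \<partial>past \<partial>slice)"
        unfolding evolve_Suc .
    qed
    \<comment> \<open>The newest slice is integrated innermost, leaving a function of the
      \<open>t\<close>-step state alone, to which the induction hypothesis applies.\<close>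
    also have "\<dots> = (\<integral>\<^sup>+ \<eta>. \<integral>\<^sup>+ \<omega>. \<integral>\<^sup>+ \<zeta>. f (step p (evolve p t \<eta> \<omega>) \<zeta>) \<partial>slice \<partial>past \<partial>\<nu>)"
    proof (rule nn_integral_cong)
      fix \<eta>
      have "(\<lambda>y. (evolve p t \<eta> (snd y), fst y)) \<in> slice \<Otimes>\<^sub>M past \<rightarrow>\<^sub>M CS \<Otimes>\<^sub>M slice"
        by (intro measurable_Pair measurable_compose[OF measurable_snd ev] measurable_fst)
      from measurable_compose[OF measurable_compose[OF this step'] f]
      show "(\<integral>\<^sup>+ \<zeta>. \<integral>\<^sup>+ \<omega>. f (step p (evolve p t \<eta> \<omega>) \<zeta>) \<partial>past \<partial>slice)
          = (\<integral>\<^sup>+ \<omega>. \<integral>\<^sup>+ \<zeta>. f (step p (evolve p t \<eta> \<omega>) \<zeta>) \<partial>slice \<partial>past)"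
        by (intro sp.Fubini'[symmetric]) (simp add: split_beta')
    qed
    also have "\<dots> = (\<integral>\<^sup>+ \<eta>. \<integral>\<^sup>+ \<zeta>. f (step p \<eta> \<zeta>) \<partial>slice \<partial>\<nu>)"
    proof -
      have h: "(\<lambda>\<eta>. \<integral>\<^sup>+ \<zeta>. f (step p \<eta> \<zeta>) \<partial>slice) \<in> borel_measurable CS"
        using measurable_compose[OF step' f] sl.borel_measurable_nn_integral[of "\<lambda>\<eta> \<zeta>. f (step p \<eta> \<zeta>)" CS]
        by (simp add: split_beta')
      have "(\<integral>\<^sup>+ \<eta>. \<integral>\<^sup>+ \<omega>. \<integral>\<^sup>+ \<zeta>. f (step p (evolve p t \<eta> \<omega>) \<zeta>) \<partial>slice \<partial>past \<partial>\<nu>)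
          = (\<integral>\<^sup>+ y. (\<integral>\<^sup>+ \<zeta>. f (step p (evolve p t (fst y) (snd y)) \<zeta>) \<partial>slice) \<partial>(\<nu> \<Otimes>\<^sub>M past))"
        using measurable_compose[OF measurable_evolve[of t] h]
        by (subst past.nn_integral_fst[symmetric]) (auto simp: split_beta')
      also have "\<dots> = (\<integral>\<^sup>+ \<eta>. \<integral>\<^sup>+ \<zeta>. f (step p \<eta> \<zeta>) \<partial>slice \<partial>distr (\<nu> \<Otimes>\<^sub>M past) CS (\<lambda>(\<eta>, \<omega>). evolve p t \<eta> \<omega>))"
        by (subst nn_integral_distr'[OF measurable_evolve h]) (simp add: split_beta')
      finally show ?thesis
        unfolding Suc .
    qed
    also have "\<dots> = (\<integral>\<^sup>+ y. f (step p (fst y) (snd y)) \<partial>(\<nu> \<Otimes>\<^sub>M slice))"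
      using measurable_compose[OF measurable_step f]
      by (subst sl.nn_integral_fst[symmetric]) (auto simp: split_beta')
    also have "\<dots> = (\<integral>\<^sup>+ y. f y \<partial>distr (\<nu> \<Otimes>\<^sub>M slice) CS (\<lambda>(\<eta>, \<zeta>). step p \<eta> \<zeta>))"
      by (subst nn_integral_distr'[OF measurable_step f]) (simp add: split_beta')
    also have "\<dots> = emeasure \<nu> A"
      unfolding distr_step f_def using A by (simp add: sets_nu)
    finally show "emeasure (distr (\<nu> \<Otimes>\<^sub>M past) CS (\<lambda>(\<eta>, \<omega>). evolve p (Suc t) \<eta> \<omega>)) A = emeasure \<nu> A" .
  qed (simp add: sets_nu)
qed

end

section \<open>Flatness of the averaged fluctuation\<close>

lemma distr_pair_snd:
  assumes "prob_space N" "sigma_finite_measure M"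
  shows "distr (N \<Otimes>\<^sub>M M) M snd = M"
proof (rule measure_eqI)
  interpret N: prob_space N by fact
  interpret M: sigma_finite_measure M by fact
  fix A assume "A \<in> sets (distr (N \<Otimes>\<^sub>M M) M snd)"
  then have A: "A \<in> sets M" by simp
  have "snd -` A \<inter> space (N \<Otimes>\<^sub>M M) = space N \<times> A"
    using sets.sets_into_space[OF A] by (auto simp: space_pair_measure)
  then show "emeasure (distr (N \<Otimes>\<^sub>M M) M snd) A = emeasure M A"
    using A by (simp add: emeasure_distr M.emeasure_pair_measure_Times N.emeasure_space_1)
qed simp

text \<open>Almost sure convergence implies convergence in law, and here the law along the sequence
  is constant. Sitewise convergence is convergence in the product topology.\<close>

lemma distr_eq_of_AE_tendsto:
  fixes X :: "nat \<Rightarrow> 'a \<Rightarrow> 'i::countable \<Rightarrow> 'b::{metric_space, second_countable_topology}"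
  assumes M: "prob_space M"
    and X: "\<And>k. X k \<in> M \<rightarrow>\<^sub>M Pi\<^sub>M UNIV (\<lambda>_. borel)" "\<And>k. distr M (Pi\<^sub>M UNIV (\<lambda>_. borel)) (X k) = N"
    and Y: "Y \<in> M \<rightarrow>\<^sub>M Pi\<^sub>M UNIV (\<lambda>_. borel)"
    and lim: "AE \<omega> in M. \<forall>x. (\<lambda>k. X k \<omega> x) \<longlonglongrightarrow> Y \<omega> x"
  shows "distr M (Pi\<^sub>M UNIV (\<lambda>_. borel)) Y = N"
proof -
  interpret M: prob_space M by fact
  let ?P = "Pi\<^sub>M UNIV (\<lambda>_. borel) :: ('i \<Rightarrow> 'b) measure"
  \<comment> \<open>Countability of the index type identifies the product sigma-algebra with the
    Borel sets of a metrizable function space.\<close>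
  have sets: "sets ?P = sets borel"
    by (rule sets_PiM_equal_borel)
  let ?L = "distr M borel Y"
  have X': "X k \<in> borel_measurable M" and Y': "Y \<in> borel_measurable M" for k
    using X(1) Y by (simp_all cong: measurable_cong_sets add: sets)
  have eq: "distr M ?P f = distr M borel f" for f
    by (rule distr_cong) (simp_all add: sets)
  define Q where "Q = distr M borel (X 0)"
  have N: "distr M borel (X k) = Q" for k
    unfolding Q_def using X(2) by (metis eq)
  have lim': "AE \<omega> in M. (\<lambda>k. X k \<omega>) \<longlonglongrightarrow> Y \<omega>"
    using lim
    by eventually_elim
      (simp add: limitin_componentwise flip: limitin_canonical_iff euclidean_product_topology)
  interpret Q: prob_space Q
    unfolding Q_def by (rule M.prob_space_distr[OF X'])
  interpret L: prob_space ?L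
    by (rule M.prob_space_distr[OF Y'])
  have [simp]: "sets Q = sets borel" "space Q = UNIV"
    by (simp_all add: Q_def)
  have int_eq: "(\<integral>y. h y \<partial>Q) = (\<integral>y. h y \<partial>?L)"
    if h: "continuous_on UNIV h" "\<And>y. \<bar>h y\<bar> \<le> 1" for h :: "('i \<Rightarrow> 'b) \<Rightarrow> real"
  proof -
    have hm [measurable]: "h \<in> borel_measurable borel"
      using h(1) by (rule borel_measurable_continuous_onI)
    have "(\<lambda>k. \<integral>\<omega>. h (X k \<omega>) \<partial>M) \<longlonglongrightarrow> (\<integral>\<omega>. h (Y \<omega>) \<partial>M)"
    proof (rule integral_dominated_convergence[where w = "\<lambda>_. 1"])
      show "AE \<omega> in M. (\<lambda>k. h (X k \<omega>)) \<longlonglongrightarrow> h (Y \<omega>)"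
        using lim' by eventually_elim (rule continuous_on_tendsto_compose[OF h(1)], auto)
    qed (use h X' Y' hm in \<open>auto intro: measurable_compose\<close>)
    moreover have "(\<integral>\<omega>. h (X k \<omega>) \<partial>M) = (\<integral>y. h y \<partial>Q)" for k
      unfolding N[of k, symmetric] by (rule integral_distr[OF X' hm, symmetric])
    moreover have "(\<integral>\<omega>. h (Y \<omega>) \<partial>M) = (\<integral>y. h y \<partial>?L)"
      by (rule integral_distr[OF Y' hm, symmetric])
    ultimately show ?thesis
      by (simp add: LIMSEQ_const_iff)
  qed
  have "Q = ?L"
  proof (rule measure_eqI_generator_eq[where E = "Collect closed" and \<Omega> = UNIV and A = "\<lambda>_. UNIV"])
    fix F :: "('i \<Rightarrow> 'b) set" assume "F \<in> Collect closed"
    then have F: "closed F" "F \<in> sets borel" by auto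
    show "emeasure Q F = emeasure ?L F"
    proof (cases "F = {}")
      case False
      \<comment> \<open>Continuous functions decreasing to the indicator of \<open>F\<close>. The
        empty set is treated apart because \<open>infdist\<close> to it is 0 by convention.\<close>
      define h where "h n y = max 0 (1 - real n * infdist y F)" for n y
      have h: "continuous_on UNIV (h n)" "\<bar>h n y\<bar> \<le> 1" "h n \<in> borel_measurable borel" for n y
      proof -
        show c: "continuous_on UNIV (h n)"
          unfolding h_def by (intro continuous_intros)
        show "\<bar>h n y\<bar> \<le> 1"
          unfolding h_def using infdist_nonneg[of y F] by auto
        show "h n \<in> borel_measurable borel"
          using c by (rule borel_measurable_continuous_onI)
      qed
      have hl: "(\<lambda>n. h n y) \<longlonglongrightarrow> indicator F y" for y
      proof (cases "y \<in> F")
        case True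
        then show ?thesis
          by (simp add: h_def)
      next
        case y: False
        then have pos: "infdist y F > 0"
          using in_closed_iff_infdist_zero[OF F(1) False] infdist_nonneg[of y F] by fastforce
        then obtain n0 :: nat where n0: "1 / infdist y F < n0"
          using reals_Archimedean2 by blast
        have "h n y = indicator F y" if "n \<ge> n0" for n
        proof -
          have "1 / infdist y F < n"
            using n0 that by linarith
          then show ?thesis
            using pos y by (simp add: h_def field_simps)
        qed
        then show ?thesis
          by (intro tendsto_eventually eventually_sequentiallyI)
      qed
      have lims: "(\<lambda>n. \<integral>y. h n y \<partial>R) \<longlonglongrightarrow> measure R F" if "prob_space R" "sets R = sets borel" for R
      proof -
        interpret R: prob_space R by fact
        have "(\<lambda>n. \<integral>y. h n y \<partial>R) \<longlonglongrightarrow> (\<integral>y. indicator F y \<partial>R)"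
        proof (rule integral_dominated_convergence[where w = "\<lambda>_. 1"])
          show "AE y in R. (\<lambda>n. h n y) \<longlonglongrightarrow> indicator F y"
            using hl by simp
        qed (use h F that in \<open>auto cong: measurable_cong_sets\<close>)
        then show ?thesis
          using F that by simp
      qed
      have "measure Q F = measure ?L F"
        using LIMSEQ_unique[OF lims[OF Q.prob_space_axioms]] lims[OF L.prob_space_axioms] int_eq[OF h(1,2)] by simp
      then show ?thesis
        by (simp add: Q.emeasure_eq_measure L.emeasure_eq_measure)
    qed simp
  qed (auto simp: Int_stable_def borel_eq_closed)
  then show ?thesis
    using N X(2) eq by metis
qed

text \<open>Turns smallness in mean at a summable rate into almost sure convergence; the reason for
  passing to a subsequence of times later.\<close>

lemma AE_summable_of_integrals:
  fixes f :: "nat \<Rightarrow> 'a \<Rightarrow> real"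
  assumes f: "\<And>k. integrable M (f k)" "\<And>k \<omega>. 0 \<le> f k \<omega>" and sum: "summable (\<lambda>k. \<integral>\<omega>. f k \<omega> \<partial>M)"
  shows "AE \<omega> in M. summable (\<lambda>k. f k \<omega>)"
proof -
  have [measurable]: "f k \<in> borel_measurable M" for k
    using f(1) by auto
  have "(\<integral>\<^sup>+ \<omega>. (\<Sum>k. ennreal (f k \<omega>)) \<partial>M) = (\<Sum>k. \<integral>\<^sup>+ \<omega>. ennreal (f k \<omega>) \<partial>M)"
    by (rule nn_integral_suminf) measurable
  also have "\<dots> = (\<Sum>k. ennreal (\<integral>\<omega>. f k \<omega> \<partial>M))"
    using f by (simp add: nn_integral_eq_integral)
  also have "\<dots> = ennreal (\<Sum>k. \<integral>\<omega>. f k \<omega> \<partial>M)"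
    using sum f by (intro suminf_ennreal2) (auto intro: integral_nonneg)
  finally have "AE \<omega> in M. (\<Sum>k. ennreal (f k \<omega>)) \<noteq> \<infinity>"
    by (intro nn_integral_PInf_AE) auto
  then show ?thesis
    by eventually_elim (intro summable_suminf_not_top, auto simp: f)
qed

lemma tendsto_avg:
  fixes f :: "'a \<Rightarrow> int^'d::finite \<Rightarrow> 'b::real_normed_vector"
  assumes "\<And>x. ((\<lambda>s. f s x) \<longlongrightarrow> g x) F"
  shows "((\<lambda>s. avg p t (f s) x) \<longlongrightarrow> avg p t g x) F"
proof (induction t arbitrary: x)
  case (Suc t)
  then show ?case
    unfolding avg.simps by (intro tendsto_sum tendsto_scaleR tendsto_const)
qed (use assms in simp)

section \<open>Growth hypothesis and flatness in mean of the averaged fluctuation\<close>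

locale sublinear_chain = stationary_chain p \<mu> \<nu>
  for p :: "int^'d::finite \<Rightarrow> real" and \<mu> and \<nu> :: "(int^'d \<Rightarrow> real^'d) measure" +
  fixes u :: "int^'d \<Rightarrow> real^'d"
  assumes integrable_eta: "\<And>x. integrable \<nu> (\<lambda>\<eta>. \<eta> x)"
    and harm: "harmonic p u"
    and dev_tendsto: "(dev \<nu> u \<longlongrightarrow> 0) at_top"
begin

sublocale nu: prob_space \<nu> by (rule prob_nu)

sublocale past: prob_space past by (rule prob_past)

sublocale joint: pair_prob_space \<nu> past ..

definition fluct :: "(int^'d \<Rightarrow> real^'d) \<Rightarrow> int^'d \<Rightarrow> real^'d" where
  "fluct \<eta> x = \<eta> x - u x"

lemma integrable_fluct: "integrable \<nu> (\<lambda>\<eta>. fluct \<eta> x)"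
  unfolding fluct_def using integrable_eta by simp

lemma integrable_avg_fluct: "integrable \<nu> (\<lambda>\<eta>. avg p t (fluct \<eta>) x)"
  by (intro integrable_avg integrable_fluct)

lemma avg_fluct_evolve:
  "avg p t (fluct (evolve p s \<eta> \<omega>)) x = avg p (t + s) (fluct \<eta>) x + avg p t (pert p s \<omega>) x"
proof -
  have "fluct (evolve p s \<eta> \<omega>) = (\<lambda>y. avg p s (fluct \<eta>) y + pert p s \<omega> y)"
    using avg_harmonic[OF harm, of s]
    by (simp add: fun_eq_iff fluct_def[abs_def] evolve_def avg_diff)
  then show ?thesis
    by (simp add: avg_add avg_avg)
qed

lemma integral_norm_fluct_le:
  assumes "e > 0"
  shows "\<exists>R\<ge>1. \<forall>r\<ge>R. \<forall>x :: int^'d. znorm x \<le> r \<longrightarrow> (\<integral>\<eta>. norm (fluct \<eta> x) \<partial>\<nu>) \<le> e * sqrt r"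
proof -
  have "\<forall>\<^sub>F r in at_top. dev \<nu> u r < e"
    using order_tendstoD(2)[OF dev_tendsto assms] .
  then obtain R where R: "\<And>r. r \<ge> R \<Longrightarrow> dev \<nu> u r < e"
    by (auto simp: eventually_at_top_linorder)
  show ?thesis
  proof (intro exI[of _ "max R 1"] conjI allI impI)
    fix r and x :: "int^'d" assume r: "max R 1 \<le> r" and x: "znorm x \<le> r"
    let ?f = "\<lambda>x. \<integral>\<eta>. norm (fluct \<eta> x) \<partial>\<nu>"
    have "?f x \<le> Max (?f ` {x. znorm x \<le> r})"
      using x finite_znorm_ball[of r] by (intro Max_ge) auto
    have eq: "r powr (-1/2) = 1 / sqrt r"
      using r powr_minus_divide[of r "1/2"] by (simp add: powr_half_sqrt)
    have "1 / sqrt r * Max (?f ` {x. znorm x \<le> r}) < e"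
      using R[of r] r unfolding dev_def eq by (simp add: fluct_def)
    then have "Max (?f ` {x. znorm x \<le> r}) < e * sqrt r"
      using r by (simp add: divide_less_eq)
    then show "?f x \<le> e * sqrt r"
      using \<open>?f x \<le> Max _\<close> by linarith
  qed simp
qed

lemma avg_fluct_flat:
  "(\<lambda>s. \<integral>\<eta>. norm (avg p s (fluct \<eta>) x - avg p s (fluct \<eta>) y) \<partial>\<nu>) \<longlonglongrightarrow> 0"
proof (rule LIMSEQ_I)
  fix e :: real assume e: "e > 0"
  obtain C where C: "C \<ge> 0" "\<And>t B. finite B \<Longrightarrow>
      (\<Sum>z\<in>B. \<bar>pk p t (z - x) - pk p t (z - y)\<bar>) \<le> C / sqrt (t + 1)"
    using pk_l1_difference[of x y] by blast
  \<comment> \<open>Both kernels of order \<open>s\<close>, centred at \<open>x\<close> and at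
    \<open>y\<close>, live within radius \<open>(s + 1) * K\<close>; then
    \<open>sqrt (s + 1)\<close> cancels against the smoothing factor.\<close>
  define K where "K = reach + znorm x + znorm y + 1"
  have K: "K \<ge> 1"
    using reach(1) by (simp add: K_def)
  \<comment> \<open>The final bound \<open>C * e' * sqrt K\<close> becomes
    \<open>e * C / (2 * (C + 1)) < e\<close>; using \<open>C + 1\<close> avoids division by
    zero.\<close>
  define e' where "e' = e / (2 * (C + 1) * sqrt K)"
  have e': "e' > 0"
    using e C K by (simp add: e'_def)
  from integral_norm_fluct_le[OF this] obtain R where R: "R \<ge> 1" "\<And>r z. R \<le> r \<Longrightarrow> znorm z \<le> r \<Longrightarrow>
      (\<integral>\<eta>. norm (fluct \<eta> z) \<partial>\<nu>) \<le> e' * sqrt r"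
    by blast
  show "\<exists>s0. \<forall>s\<ge>s0. norm ((\<integral>\<eta>. norm (avg p s (fluct \<eta>) x - avg p s (fluct \<eta>) y) \<partial>\<nu>) - 0) < e"
  proof (intro exI[of _ "nat \<lceil>R\<rceil>"] allI impI)
    fix s assume s: "nat \<lceil>R\<rceil> \<le> s"
    define B where "B = {z. pk p s (z - x) \<noteq> 0} \<union> {z. pk p s (z - y) \<noteq> 0}"
    have B: "finite B"
      by (simp add: B_def)
    define r where "r = (s + 1) * K"
    have "(real s + 1) * 1 \<le> r"
      unfolding r_def using K by (intro mult_mono) auto
    moreover have "R \<le> s"
      using s by linarith
    ultimately have r: "R \<le> r" by simp
    have zr: "znorm z \<le> r" if "z \<in> B" for z
    proof -
      have "znorm z \<le> s * reach + znorm x + znorm y"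
        using that znorm_le_of_pk[of s "z - x"] znorm_le_of_pk[of s "z - y"]
          znorm_add[of "z - x" x] znorm_add[of "z - y" y] znorm_nonneg[of x] znorm_nonneg[of y]
        unfolding B_def by (auto simp del: znorm_nonneg)
      also have "\<dots> \<le> s * reach + reach + 1 * (znorm x + znorm y + 1)"
        using reach(1) by simp
      also have "\<dots> \<le> s * reach + reach + (s + 1) * (znorm x + znorm y + 1)"
        by (intro add_left_mono mult_right_mono) auto
      also have "\<dots> = r"
        by (simp add: r_def K_def algebra_simps)
      finally show ?thesis .
    qed
    have "(\<integral>\<eta>. norm (avg p s (fluct \<eta>) x - avg p s (fluct \<eta>) y) \<partial>\<nu>)
        \<le> (\<integral>\<eta>. (\<Sum>z\<in>B. \<bar>pk p s (z - x) - pk p s (z - y)\<bar> * norm (fluct \<eta> z)) \<partial>\<nu>)"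
    proof (rule integral_mono)
      fix \<eta>
      have "avg p s (fluct \<eta>) x - avg p s (fluct \<eta>) y = (\<Sum>z\<in>B. (pk p s (z - x) - pk p s (z - y)) *\<^sub>R fluct \<eta> z)"
        by (rule avg_diff_eq_sum[OF B]) (auto simp: B_def)
      then show "norm (avg p s (fluct \<eta>) x - avg p s (fluct \<eta>) y)
          \<le> (\<Sum>z\<in>B. \<bar>pk p s (z - x) - pk p s (z - y)\<bar> * norm (fluct \<eta> z))"
        by (metis (no_types, lifting) norm_scaleR norm_sum sum.cong)
    qed (intro integrable_norm Bochner_Integration.integrable_diff Bochner_Integration.integrable_sum
        integrable_mult_right integrable_avg_fluct integrable_fluct)+
    also have "\<dots> = (\<Sum>z\<in>B. \<bar>pk p s (z - x) - pk p s (z - y)\<bar> * (\<integral>\<eta>. norm (fluct \<eta> z) \<partial>\<nu>))"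
      using integrable_fluct by (subst Bochner_Integration.integral_sum) auto
    also have "\<dots> \<le> (\<Sum>z\<in>B. \<bar>pk p s (z - x) - pk p s (z - y)\<bar> * (e' * sqrt r))"
      by (intro sum_mono mult_left_mono R(2)[OF r] zr) auto
    also have "\<dots> \<le> C / sqrt (s + 1) * (e' * sqrt r)"
      unfolding sum_distrib_right[symmetric] using C(2)[OF B] e' r R(1) by (intro mult_right_mono) auto
    also have "\<dots> = C * e' * sqrt K"
      by (simp add: r_def real_sqrt_mult)
    also have "\<dots> = e * (C / (2 * (C + 1)))"
      using K by (simp add: e'_def)
    also have "\<dots> < e * 1"
      using C(1) e by (intro mult_strict_left_mono) (auto simp: field_simps)
    finally show "norm ((\<integral>\<eta>. norm (avg p s (fluct \<eta>) x - avg p s (fluct \<eta>) y) \<partial>\<nu>) - 0) < e"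
      by simp
  qed
qed

text \<open>For fixed \<open>t\<close>, the difference is the \<open>t\<close>-step average of
  \<open>avg p s (fluct \<eta>) z - avg p s (fluct \<eta>) 0\<close> over finitely many sites
  \<open>z\<close>, each term vanishing in mean by flatness.\<close>

lemma avg_fluct_shift:
  "(\<lambda>s. \<integral>\<eta>. norm (avg p (t + s) (fluct \<eta>) 0 - avg p s (fluct \<eta>) 0) \<partial>\<nu>) \<longlonglongrightarrow> 0"
proof (rule tendsto_sandwich[where f = "\<lambda>_. 0"])
  let ?g = "\<lambda>s z. \<integral>\<eta>. norm (avg p s (fluct \<eta>) z - avg p s (fluct \<eta>) 0) \<partial>\<nu>"
  show "\<forall>\<^sub>F s in sequentially. (\<integral>\<eta>. norm (avg p (t + s) (fluct \<eta>) 0 - avg p s (fluct \<eta>) 0) \<partial>\<nu>) \<le> avg p t (?g s) 0"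
  proof (intro always_eventually allI)
    fix s
    have int: "integrable \<nu> (\<lambda>\<eta>. norm (avg p s (fluct \<eta>) z - avg p s (fluct \<eta>) 0))" for z
      using integrable_avg_fluct by simp
    have "norm (avg p (t + s) (fluct \<eta>) 0 - avg p s (fluct \<eta>) 0)
        \<le> avg p t (\<lambda>z. norm (avg p s (fluct \<eta>) z - avg p s (fluct \<eta>) 0)) 0" for \<eta>
      using norm_avg_le[of t "\<lambda>z. avg p s (fluct \<eta>) z - avg p s (fluct \<eta>) 0" 0]
      by (simp add: avg_diff avg_const avg_avg)
    then have "(\<integral>\<eta>. norm (avg p (t + s) (fluct \<eta>) 0 - avg p s (fluct \<eta>) 0) \<partial>\<nu>)
        \<le> (\<integral>\<eta>. avg p t (\<lambda>z. norm (avg p s (fluct \<eta>) z - avg p s (fluct \<eta>) 0)) 0 \<partial>\<nu>)"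
      using integrable_avg_fluct int by (intro integral_mono integrable_avg) auto
    then show "(\<integral>\<eta>. norm (avg p (t + s) (fluct \<eta>) 0 - avg p s (fluct \<eta>) 0) \<partial>\<nu>) \<le> avg p t (?g s) 0"
      by (simp only: integral_avg[OF int])
  qed
  show "(\<lambda>s. avg p t (?g s) 0) \<longlonglongrightarrow> 0"
    using tendsto_avg[of "\<lambda>s. ?g s" "\<lambda>_. 0" sequentially p t 0] avg_fluct_flat by (simp add: avg_const)
qed auto

end

section \<open>The random constant and the mixture\<close>

context sublinear_chain
begin

lemma
  fixes g :: "_ \<Rightarrow> 'b::{banach, second_countable_topology}"
  assumes "integrable \<nu> g"
  shows integrable_joint_fst: "integrable (\<nu> \<Otimes>\<^sub>M past) (\<lambda>y. g (fst y))"
    and integral_joint_fst: "(\<integral>y. g (fst y) \<partial>(\<nu> \<Otimes>\<^sub>M past)) = (\<integral>\<eta>. g \<eta> \<partial>\<nu>)"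
  using assms integrable_distr[of fst "\<nu> \<Otimes>\<^sub>M past" \<nu> g] integral_distr[of fst "\<nu> \<Otimes>\<^sub>M past" \<nu> g]
  by (simp_all add: past.distr_pair_fst)

lemma
  fixes g :: "_ \<Rightarrow> 'b::{banach, second_countable_topology}"
  assumes "integrable past g"
  shows integrable_joint_snd: "integrable (\<nu> \<Otimes>\<^sub>M past) (\<lambda>y. g (snd y))"
    and integral_joint_snd: "(\<integral>y. g (snd y) \<partial>(\<nu> \<Otimes>\<^sub>M past)) = (\<integral>\<omega>. g \<omega> \<partial>past)"
  using assms integrable_distr[of snd "\<nu> \<Otimes>\<^sub>M past" past g] integral_distr[of snd "\<nu> \<Otimes>\<^sub>M past" past g]
  by (simp_all add: distr_pair_snd[OF nu.prob_space_axioms past.sigma_finite_measure_axioms])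

lemma integral_evolve:
  fixes g :: "_ \<Rightarrow> 'b::{banach, second_countable_topology}"
  assumes "g \<in> borel_measurable \<nu>"
  shows "(\<integral>\<eta>. g \<eta> \<partial>\<nu>) = (\<integral>y. g (evolve p s (fst y) (snd y)) \<partial>(\<nu> \<Otimes>\<^sub>M past))"
proof -
  have "g \<in> borel_measurable CS"
    using assms by (simp cong: measurable_cong_sets add: sets_nu)
  from integral_distr[OF measurable_evolve[of s] this] show ?thesis
    unfolding distr_evolve by (simp add: split_beta')
qed

text \<open>By stationarity \<open>\<eta>\<close> may be replaced by its state after
  \<open>s\<close> steps. The initial-data parts of both averages are compared with the common
  \<open>avg p s (fluct \<eta>) 0\<close>, and what survives is bounded by the two noise
  remainders.\<close>

lemma avg_fluct_cauchy:
  "(\<integral>\<eta>. norm (avg p t (fluct \<eta>) 0 - avg p t' (fluct \<eta>) 0) \<partial>\<nu>) \<le> remainder t + remainder t'"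
    (is "?E \<le> _")
proof -
  define a where "a t s \<eta> = norm (avg p (t + s) (fluct \<eta>) 0 - avg p s (fluct \<eta>) 0)" for t s \<eta>
  define b where "b t s \<omega> = norm (avg p t (pert p s \<omega>) 0)" for t s and \<omega> :: "nat \<Rightarrow> int^'d \<Rightarrow> real"
  have a: "integrable \<nu> (a t s)" for t s
    unfolding a_def using integrable_avg_fluct by simp
  have b: "integrable past (b t s)" "(\<integral>\<omega>. b t s \<omega> \<partial>past) \<le> remainder t" for t s
    unfolding b_def using integrable_avg_pert integral_norm_avg_pert by simp_all
  note ab = integrable_joint_fst[OF a] integrable_joint_snd[OF b(1)]
  have bound: "?E \<le> (\<integral>\<eta>. a t s \<eta> \<partial>\<nu>) + (\<integral>\<eta>. a t' s \<eta> \<partial>\<nu>) + (remainder t + remainder t')" for s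
  proof -
    let ?h = "\<lambda>y. norm (avg p t (fluct (evolve p s (fst y) (snd y))) 0 - avg p t' (fluct (evolve p s (fst y) (snd y))) 0)"
    have le: "?h y \<le> (a t s (fst y) + a t' s (fst y)) + (b t s (snd y) + b t' s (snd y))" for y
    proof -
      let ?P = "avg p (t + s) (fluct (fst y)) 0" and ?P' = "avg p (t' + s) (fluct (fst y)) 0" and ?S = "avg p s (fluct (fst y)) 0"
        and ?D = "avg p t (pert p s (snd y)) 0" and ?D' = "avg p t' (pert p s (snd y)) 0"
      have "?h y = norm (((?P - ?S) - (?P' - ?S)) + (?D - ?D'))"
        by (simp add: avg_fluct_evolve algebra_simps)
      also have "\<dots> \<le> (norm (?P - ?S) + norm (?P' - ?S)) + (norm ?D + norm ?D')"
        by (intro norm_triangle_le add_mono norm_triangle_ineq4)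
      finally show ?thesis
        by (simp add: a_def b_def)
    qed
    have "?E = (\<integral>y. ?h y \<partial>(\<nu> \<Otimes>\<^sub>M past))"
      using integrable_avg_fluct by (intro integral_evolve) (auto intro: borel_measurable_integrable)
    also have "\<dots> \<le> (\<integral>y. (a t s (fst y) + a t' s (fst y)) + (b t s (snd y) + b t' s (snd y)) \<partial>(\<nu> \<Otimes>\<^sub>M past))"
      using ab by (intro integral_mono' le order_trans[OF norm_ge_zero le]) auto
    also have "\<dots> = (\<integral>\<eta>. a t s \<eta> \<partial>\<nu>) + (\<integral>\<eta>. a t' s \<eta> \<partial>\<nu>) + ((\<integral>\<omega>. b t s \<omega> \<partial>past) + (\<integral>\<omega>. b t' s \<omega> \<partial>past))"
      using ab a b(1) by (simp add: integral_joint_fst integral_joint_snd)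
    also have "\<dots> \<le> (\<integral>\<eta>. a t s \<eta> \<partial>\<nu>) + (\<integral>\<eta>. a t' s \<eta> \<partial>\<nu>) + (remainder t + remainder t')"
      by (intro add_left_mono add_mono b(2))
    finally show ?thesis .
  qed
  \<comment> \<open>The quantity to be bounded does not involve \<open>s\<close>, so the limit in
    \<open>s\<close> may be taken on the right alone.\<close>
  have "(\<lambda>s. (\<integral>\<eta>. a t s \<eta> \<partial>\<nu>) + (\<integral>\<eta>. a t' s \<eta> \<partial>\<nu>) + (remainder t + remainder t'))
      \<longlonglongrightarrow> 0 + 0 + (remainder t + remainder t')"
    unfolding a_def by (intro tendsto_add avg_fluct_shift tendsto_const)
  then show ?thesis
    using bound LIMSEQ_le_const by fastforce
qed

text \<open>The random constant \<open>\<alpha>\<close> mixing the measures \<open>\<pi>\<close> is the limit of the averages of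
  \<open>\<eta> - u\<close> at the origin, which form a Cauchy sequence in \<open>L\<^sup>1(\<nu>)\<close>.\<close>

lemma random_constant:
  "\<exists>(\<tau> :: nat \<Rightarrow> nat) \<alpha>. (\<forall>k. k \<le> \<tau> k) \<and> \<alpha> \<in> borel_measurable \<nu> \<and>
     (AE \<eta> in \<nu>. \<forall>x. (\<lambda>k. avg p (\<tau> k) (fluct \<eta>) x) \<longlonglongrightarrow> \<alpha> \<eta>)"
proof -
  let ?g = "\<lambda>t x. \<integral>\<eta>. norm (avg p t (fluct \<eta>) x - avg p t (fluct \<eta>) 0) \<partial>\<nu>"
  \<comment> \<open>Geometric rates give summability. Flatness is imposed only at the first sites of
    an enumeration, since it is not uniform over the lattice.\<close>
  have "\<exists>t\<ge>k. remainder t \<le> (1/2)^k \<and> (\<forall>j\<le>k. ?g t (from_nat j) \<le> (1/2)^k)" for k :: nat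
  proof -
    have "\<forall>\<^sub>F t in sequentially. remainder t < (1/2)^k"
      using order_tendstoD(2)[OF remainder_tendsto] by simp
    moreover have "\<forall>\<^sub>F t in sequentially. \<forall>j\<in>{..k}. ?g t (from_nat j) < (1/2)^k"
      by (intro eventually_ball_finite ballI order_tendstoD(2)[OF avg_fluct_flat]) auto
    ultimately have "\<forall>\<^sub>F t in sequentially. k \<le> t \<and> remainder t \<le> (1/2)^k \<and> (\<forall>j\<le>k. ?g t (from_nat j) \<le> (1/2)^k)"
      using eventually_ge_at_top[of k] by eventually_elim (auto intro: less_imp_le)
    then show ?thesis
      by (auto simp: eventually_sequentially)
  qed
  then have "\<exists>\<tau>. \<forall>k. k \<le> \<tau> k \<and> remainder (\<tau> k) \<le> (1/2)^k \<and> (\<forall>j\<le>k. ?g (\<tau> k) (from_nat j) \<le> (1/2)^k)"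
    by (intro choice allI)
  then obtain \<tau> where \<tau>: "\<And>k. k \<le> \<tau> k" "\<And>k. remainder (\<tau> k) \<le> (1/2)^k"
      "\<And>k j. j \<le> k \<Longrightarrow> ?g (\<tau> k) (from_nat j) \<le> (1/2)^k"
    by blast
  define A where "A k \<eta> = avg p (\<tau> k) (fluct \<eta>) 0" for k \<eta>
  have A: "integrable \<nu> (A k)" for k
    unfolding A_def by (rule integrable_avg_fluct)
  then have [measurable]: "A k \<in> borel_measurable \<nu>" for k
    by auto
  have geo: "summable (\<lambda>k. (1/2 :: real)^k)"
    by (rule summable_geometric) simp
  have "AE \<eta> in \<nu>. summable (\<lambda>k. norm (A (Suc k) \<eta> - A k \<eta>))"
  proof (rule AE_summable_of_integrals)
    show "summable (\<lambda>k. \<integral>\<eta>. norm (A (Suc k) \<eta> - A k \<eta>) \<partial>\<nu>)"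
    proof (rule summable_comparison_test)
      have "(\<integral>\<eta>. norm (A (Suc k) \<eta> - A k \<eta>) \<partial>\<nu>) \<le> 2 * (1/2)^k" for k
      proof -
        have "(1/2::real)^Suc k \<le> (1/2)^k"
          by simp
        then show ?thesis
          using avg_fluct_cauchy[of "\<tau> (Suc k)" "\<tau> k"] \<tau>(2)[of k] \<tau>(2)[of "Suc k"] unfolding A_def by linarith
      qed
      then show "\<exists>N. \<forall>k\<ge>N. norm (\<integral>\<eta>. norm (A (Suc k) \<eta> - A k \<eta>) \<partial>\<nu>) \<le> 2 * (1/2)^k"
        by simp
    qed (intro summable_mult geo)
  qed (use A in auto)
  moreover have "AE \<eta> in \<nu>. summable (\<lambda>k. norm (avg p (\<tau> k) (fluct \<eta>) x - A k \<eta>))" for x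
  proof (rule AE_summable_of_integrals)
    show "summable (\<lambda>k. \<integral>\<eta>. norm (avg p (\<tau> k) (fluct \<eta>) x - A k \<eta>) \<partial>\<nu>)"
    proof (rule summable_comparison_test[OF _ geo])
      show "\<exists>N. \<forall>k\<ge>N. norm (\<integral>\<eta>. norm (avg p (\<tau> k) (fluct \<eta>) x - A k \<eta>) \<partial>\<nu>) \<le> (1/2)^k"
        \<comment> \<open>Site \<open>x\<close> is controlled from \<open>k = to_nat x\<close>
          on.\<close>
        using \<tau>(3)[of "to_nat x"] by (intro exI[of _ "to_nat x"]) (auto simp: A_def)
    qed
  qed (use A integrable_avg_fluct in auto)
  then have "AE \<eta> in \<nu>. \<forall>x. summable (\<lambda>k. norm (avg p (\<tau> k) (fluct \<eta>) x - A k \<eta>))"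
    by (simp add: AE_all_countable)
  \<comment> \<open>\<open>lim\<close> is defined for every \<open>\<eta>\<close> and measurable, so
    no exceptional set has to be removed from the definition of the constant.\<close>
  ultimately have "AE \<eta> in \<nu>. \<forall>x. (\<lambda>k. avg p (\<tau> k) (fluct \<eta>) x) \<longlonglongrightarrow> lim (\<lambda>k. A k \<eta>)"
  proof eventually_elim
    case (elim \<eta>)
    have "summable (\<lambda>k. A (Suc k) \<eta> - A k \<eta>)"
      using elim(1) by (rule summable_norm_cancel)
    moreover have "(\<Sum>k<n. A (Suc k) \<eta> - A k \<eta>) = A n \<eta> - A 0 \<eta>" for n
      by (induction n) simp_all
    ultimately obtain L where "(\<lambda>n. A n \<eta> - A 0 \<eta>) \<longlonglongrightarrow> L"
      by (auto simp: summable_iff_convergent convergent_def)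
    from tendsto_add[OF this tendsto_const[of "A 0 \<eta>"]] have "convergent (\<lambda>k. A k \<eta>)"
      by (auto simp: convergent_def)
    then have lim: "(\<lambda>k. A k \<eta>) \<longlonglongrightarrow> lim (\<lambda>k. A k \<eta>)"
      by (simp add: convergent_LIMSEQ_iff)
    show ?case
    proof
      fix x
      have "(\<lambda>k. avg p (\<tau> k) (fluct \<eta>) x - A k \<eta>) \<longlonglongrightarrow> 0"
        using elim(2) by (intro tendsto_norm_zero_cancel[OF summable_LIMSEQ_zero]) auto
      from tendsto_add[OF this lim] show "(\<lambda>k. avg p (\<tau> k) (fluct \<eta>) x) \<longlonglongrightarrow> lim (\<lambda>k. A k \<eta>)"
        by simp
    qed
  qed
  moreover have "(\<lambda>\<eta>. lim (\<lambda>k. A k \<eta>)) \<in> borel_measurable \<nu>"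
    by measurable
  ultimately show ?thesis
    using \<tau>(1) by (intro exI[of _ \<tau>] exI[of _ "\<lambda>\<eta>. lim (\<lambda>k. A k \<eta>)"]) simp
qed

text \<open>Along the chosen times the evolved field converges almost surely on the product space:
  the averaged part depends on \<open>\<eta>\<close> only, the noise part on \<open>\<omega>\<close>
  only. Every member of the sequence has law \<open>\<nu>\<close>, so the limit does.\<close>

lemma stationary_law:
  "\<exists>\<alpha>. \<alpha> \<in> borel_measurable \<nu> \<and> distr (\<nu> \<Otimes>\<^sub>M past) CS (\<lambda>(\<eta>, \<omega>) x. u x + \<alpha> \<eta> + Delta0 p \<omega> x) = \<nu>"
proof -
  obtain \<tau> :: "nat \<Rightarrow> nat" and \<alpha> where \<tau>: "\<And>k. k \<le> \<tau> k" and \<alpha>: "\<alpha> \<in> borel_measurable \<nu>"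
    and lim: "AE \<eta> in \<nu>. \<forall>x. (\<lambda>k. avg p (\<tau> k) (fluct \<eta>) x) \<longlonglongrightarrow> \<alpha> \<eta>"
    using random_constant by blast
  \<comment> \<open>The noise part converges along all times, hence along
    \<open>\<tau>\<close>.\<close>
  have \<tau>_top: "filterlim \<tau> at_top sequentially"
    using \<tau> by (intro filterlim_at_top_mono[OF filterlim_ident]) auto
  have "AE \<eta> in distr (\<nu> \<Otimes>\<^sub>M past) \<nu> fst. \<forall>x. (\<lambda>k. avg p (\<tau> k) (fluct \<eta>) x) \<longlonglongrightarrow> \<alpha> \<eta>"
    unfolding past.distr_pair_fst by (rule lim)
  from AE_distrD[OF measurable_fst this]
  have "AE y in \<nu> \<Otimes>\<^sub>M past. \<forall>x. (\<lambda>k. avg p (\<tau> k) (fluct (fst y)) x) \<longlonglongrightarrow> \<alpha> (fst y)" .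
  moreover
  have "AE \<omega> in distr (\<nu> \<Otimes>\<^sub>M past) past snd. \<forall>x. (\<lambda>s. pert p s \<omega> x) \<longlonglongrightarrow> Delta0 p \<omega> x"
    unfolding distr_pair_snd[OF nu.prob_space_axioms past.sigma_finite_measure_axioms] by (rule AE_pert_tendsto)
  from AE_distrD[OF measurable_snd this]
  have "AE y in \<nu> \<Otimes>\<^sub>M past. \<forall>x. (\<lambda>s. pert p s (snd y) x) \<longlonglongrightarrow> Delta0 p (snd y) x" .
  ultimately have ae: "AE y in \<nu> \<Otimes>\<^sub>M past. \<forall>x. (\<lambda>k. (case y of (\<eta>, \<omega>) \<Rightarrow> evolve p (\<tau> k) \<eta> \<omega>) x)
      \<longlonglongrightarrow> (case y of (\<eta>, \<omega>) \<Rightarrow> \<lambda>x. u x + \<alpha> \<eta> + Delta0 p \<omega> x) x"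
  proof eventually_elim
    case (elim y)
    have "evolve p t \<eta> \<omega> x = u x + avg p t (fluct \<eta>) x + pert p t \<omega> x" for t \<eta> \<omega> x
      using avg_harmonic[OF harm, of t] by (simp add: evolve_def fluct_def[abs_def] avg_diff)
    then show ?case
      using elim filterlim_compose[OF elim(2)[rule_format] \<tau>_top]
      by (auto simp: split_beta intro!: tendsto_add)
  qed
  have "distr (\<nu> \<Otimes>\<^sub>M past) CS (\<lambda>(\<eta>, \<omega>) x. u x + \<alpha> \<eta> + Delta0 p \<omega> x) = \<nu>"
  proof (rule distr_eq_of_AE_tendsto[OF _ measurable_evolve distr_evolve _ ae])
    show "prob_space (\<nu> \<Otimes>\<^sub>M past)"
      by (rule joint.prob_space_axioms)
    show "(\<lambda>(\<eta>, \<omega>) x. u x + \<alpha> \<eta> + Delta0 p \<omega> x) \<in> \<nu> \<Otimes>\<^sub>M past \<rightarrow>\<^sub>M CS"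
      unfolding split_beta
      by (intro measurable_UNIV_PiM borel_measurable_add borel_measurable_const
          measurable_compose[OF measurable_fst \<alpha>] measurable_compose[OF measurable_snd measurable_Delta0])
  qed
  with \<alpha> show ?thesis by blast
qed

section \<open>The mean field and the mixing law\<close>

definition mean :: "int^'d \<Rightarrow> real^'d" where
  "mean x = (\<integral>\<eta>. \<eta> x \<partial>\<nu>)"

text \<open>A Liouville argument: the noise being centred, the mean fluctuation is fixed by every
  \<open>avg p s\<close>, and flatness in mean forces a fixed function to be constant.\<close>

lemma mean_eq: "\<exists>a. \<forall>x. mean x = u x + a"
proof -
  let ?m = "\<lambda>x. \<integral>\<eta>. fluct \<eta> x \<partial>\<nu>"
  have m: "?m x = mean x - u x" for x
    unfolding fluct_def mean_def using integrable_eta by (simp add: nu.prob_space)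
  have inv: "avg p s ?m x = ?m x" for s x
  proof -
    have "?m x = (\<integral>y. fluct (evolve p s (fst y) (snd y)) x \<partial>(\<nu> \<Otimes>\<^sub>M past))"
      using integrable_fluct by (intro integral_evolve) auto
    also have "\<dots> = (\<integral>y. avg p s (fluct (fst y)) x + pert p s (snd y) x \<partial>(\<nu> \<Otimes>\<^sub>M past))"
      using avg_fluct_evolve[where t = 0] by simp
    also have "\<dots> = (\<integral>\<eta>. avg p s (fluct \<eta>) x \<partial>\<nu>) + (\<integral>\<omega>. pert p s \<omega> x \<partial>past)"
      by (subst Bochner_Integration.integral_add[OF integrable_joint_fst[OF integrable_avg_fluct]
            integrable_joint_snd[OF integrable_pert]])
        (simp only: integral_joint_fst[OF integrable_avg_fluct] integral_joint_snd[OF integrable_pert])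
    finally show ?thesis
      by (simp add: integral_pert integral_avg[OF integrable_fluct])
  qed
  have "?m x = ?m 0" for x
  proof -
    have "norm (?m x - ?m 0) \<le> (\<integral>\<eta>. norm (avg p s (fluct \<eta>) x - avg p s (fluct \<eta>) 0) \<partial>\<nu>)" for s
    proof -
      have "?m x - ?m 0 = (\<integral>\<eta>. avg p s (fluct \<eta>) x - avg p s (fluct \<eta>) 0 \<partial>\<nu>)"
        using inv[of s] integrable_avg_fluct by (simp add: integral_avg[OF integrable_fluct])
      then show ?thesis
        by (simp add: integral_norm_bound)
    qed
    then have "norm (?m x - ?m 0) \<le> 0"
      using LIMSEQ_le_const[OF avg_fluct_flat] by blast
    then show ?thesis by simp
  qed
  then have "mean x = u x + ?m 0" for x
    using m[of x] by (metis add.commute diff_add_cancel)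
  then show ?thesis by blast
qed

lemma dev_mean_tendsto: "(dev \<nu> mean \<longlongrightarrow> 0) at_top"
proof -
  obtain a where a: "\<And>x. mean x = u x + a"
    using mean_eq by blast
  have upper: "dev \<nu> mean r \<le> dev \<nu> u r + r powr (-1/2) * norm a" and lower: "0 \<le> dev \<nu> mean r" if "r \<ge> 0" for r
  proof -
    let ?B = "{x :: int^'d. znorm x \<le> r}"
    let ?f = "\<lambda>x. \<integral>\<eta>. norm (\<eta> x - u x) \<partial>\<nu>" and ?g = "\<lambda>x. \<integral>\<eta>. norm (\<eta> x - mean x) \<partial>\<nu>"
    have B: "finite ?B" "0 \<in> ?B"
      using finite_znorm_ball that by auto
    have "?g x \<le> ?f x + norm a" for x
    proof -
      have "?g x \<le> (\<integral>\<eta>. norm (\<eta> x - u x) + norm a \<partial>\<nu>)"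
      proof (rule integral_mono)
        show "norm (\<eta> x - mean x) \<le> norm (\<eta> x - u x) + norm a" for \<eta>
          using norm_triangle_ineq4[of "\<eta> x - u x" a] by (simp add: a algebra_simps)
      qed (use integrable_eta in auto)
      then show ?thesis
        using integrable_eta by (simp add: nu.prob_space)
    qed
    then have "Max (?g ` ?B) \<le> Max (?f ` ?B) + norm a"
      using B by (intro Max.boundedI) (blast | auto intro!: order_trans[OF _ add_right_mono[OF Max_ge]])+
    then have "r powr (-1/2) * Max (?g ` ?B) \<le> r powr (-1/2) * (Max (?f ` ?B) + norm a)"
      by (rule mult_left_mono) simp
    then show "dev \<nu> mean r \<le> dev \<nu> u r + r powr (-1/2) * norm a"
      by (simp add: dev_def distrib_left)
    \<comment> \<open>For \<open>r \<ge> 0\<close> the ball contains the origin, so the maximum is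
      over a nonempty set and is nonnegative.\<close>
    have "0 \<le> ?g 0" by simp
    also have "\<dots> \<le> Max (?g ` ?B)"
      using B by (intro Max_ge) auto
    finally show "0 \<le> dev \<nu> mean r"
      by (simp add: dev_def)
  qed
  have "((\<lambda>r::real. r powr (-1/2)) \<longlongrightarrow> 0) at_top"
    by (rule tendsto_neg_powr) (auto intro: filterlim_ident)
  then have "((\<lambda>r. dev \<nu> u r + r powr (-1/2) * norm a) \<longlongrightarrow> 0 + 0 * norm a) at_top"
    by (intro tendsto_add dev_tendsto tendsto_mult tendsto_const)
  then have bound: "((\<lambda>r. dev \<nu> u r + r powr (-1/2) * norm a) \<longlongrightarrow> 0) at_top"
    by simp
  show ?thesis
  proof (rule tendsto_sandwich[OF _ _ tendsto_const bound])
    show "\<forall>\<^sub>F r in at_top. 0 \<le> dev \<nu> mean r"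
      using lower by (rule eventually_at_top_linorderI)
    show "\<forall>\<^sub>F r in at_top. dev \<nu> mean r \<le> dev \<nu> u r + r powr (-1/2) * norm a"
      using upper by (rule eventually_at_top_linorderI)
  qed
qed

text \<open>Freezing \<open>\<eta>\<close> in the stationary law leaves a deterministic shift of
  \<open>Delta0\<close>, that is a law \<open>piv\<close>; Tonelli integrates over the
  shift.\<close>

lemma mixture:
  "\<exists>\<gamma> :: (real^'d) measure. prob_space \<gamma> \<and> sets \<gamma> = sets borel \<and>
     (\<forall>A\<in>sets CS. emeasure \<nu> A = (\<integral>\<^sup>+ \<alpha>. emeasure (piv p \<mu> (\<lambda>x. mean x + \<alpha>)) A \<partial>\<gamma>))"
proof -
  obtain \<alpha> where \<alpha> [measurable]: "\<alpha> \<in> borel_measurable \<nu>"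
    and law: "distr (\<nu> \<Otimes>\<^sub>M past) CS (\<lambda>(\<eta>, \<omega>) x. u x + \<alpha> \<eta> + Delta0 p \<omega> x) = \<nu>"
    using stationary_law by blast
  obtain a where a: "\<And>x. mean x = u x + a"
    using mean_eq by blast
  \<comment> \<open>The shift by \<open>a\<close> compensates for centring at \<open>mean\<close>
    instead of \<open>u\<close>.\<close>
  define \<gamma> where "\<gamma> = distr \<nu> borel (\<lambda>\<eta>. \<alpha> \<eta> - a)"
  have "prob_space \<gamma>"
    unfolding \<gamma>_def by (rule nu.prob_space_distr) measurable
  moreover have "sets \<gamma> = sets borel"
    by (simp add: \<gamma>_def)
  moreover have "emeasure \<nu> A = (\<integral>\<^sup>+ \<beta>. emeasure (piv p \<mu> (\<lambda>x. mean x + \<beta>)) A \<partial>\<gamma>)" if A: "A \<in> sets CS" for A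
  proof -
    define F where "F = (\<lambda>(\<beta>, \<omega>) x. mean x + \<beta> + Delta0 p \<omega> x)"
    have F: "F \<in> borel \<Otimes>\<^sub>M past \<rightarrow>\<^sub>M CS"
      unfolding F_def split_beta
      by (intro measurable_UNIV_PiM borel_measurable_add borel_measurable_const measurable_fst
          measurable_compose[OF measurable_snd measurable_Delta0])
    have m: "(\<lambda>\<omega>. F (\<beta>, \<omega>)) \<in> past \<rightarrow>\<^sub>M CS" for \<beta>
      by (rule measurable_compose[OF measurable_Pair1' F]) simp
    have ind: "(indicator A :: _ \<Rightarrow> ennreal) \<in> borel_measurable CS"
      using A by simp
    have G: "(\<lambda>(\<eta>, \<omega>). F (\<alpha> \<eta> - a, \<omega>)) \<in> \<nu> \<Otimes>\<^sub>M past \<rightarrow>\<^sub>M CS"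
      unfolding split_beta by (rule measurable_compose[OF _ F]) measurable
    have piv: "emeasure (piv p \<mu> (\<lambda>x. mean x + \<beta>)) A = (\<integral>\<^sup>+ \<omega>. indicator A (F (\<beta>, \<omega>)) \<partial>past)" for \<beta>
    proof -
      have "emeasure (piv p \<mu> (\<lambda>x. mean x + \<beta>)) A = (\<integral>\<^sup>+ y. indicator A y \<partial>distr past CS (\<lambda>\<omega>. F (\<beta>, \<omega>)))"
        using A by (simp add: piv_def F_def)
      also have "\<dots> = (\<integral>\<^sup>+ \<omega>. indicator A (F (\<beta>, \<omega>)) \<partial>past)"
        by (rule nn_integral_distr'[OF m ind])
      finally show ?thesis .
    qed
    have "emeasure \<nu> A = (\<integral>\<^sup>+ y. indicator A y \<partial>distr (\<nu> \<Otimes>\<^sub>M past) CS (\<lambda>(\<eta>, \<omega>). F (\<alpha> \<eta> - a, \<omega>)))"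
      using A law by (simp add: F_def a sets_nu)
    also have "\<dots> = (\<integral>\<^sup>+ y. indicator A (F (\<alpha> (fst y) - a, snd y)) \<partial>(\<nu> \<Otimes>\<^sub>M past))"
      by (subst nn_integral_distr'[OF G ind]) (simp add: split_beta')
    also have "\<dots> = (\<integral>\<^sup>+ \<eta>. \<integral>\<^sup>+ \<omega>. indicator A (F (\<alpha> \<eta> - a, \<omega>)) \<partial>past \<partial>\<nu>)"
      using measurable_compose[OF G ind]
      by (subst past.nn_integral_fst[symmetric]) (auto simp: split_beta')
    \<comment> \<open>The inner integral depends on \<open>\<eta>\<close> only through
      \<open>\<alpha> \<eta> - a\<close>, whose law is \<open>\<gamma>\<close>.\<close>
    also have "\<dots> = (\<integral>\<^sup>+ \<beta>. \<integral>\<^sup>+ \<omega>. indicator A (F (\<beta>, \<omega>)) \<partial>past \<partial>\<gamma>)"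
      unfolding \<gamma>_def
    proof (rule nn_integral_distr'[symmetric])
      have "(\<lambda>(\<beta>, \<omega>). indicator A (F (\<beta>, \<omega>)) :: ennreal) \<in> borel_measurable (borel \<Otimes>\<^sub>M past)"
        using measurable_compose[OF F ind] by simp
      then show "(\<lambda>\<beta>. \<integral>\<^sup>+ \<omega>. indicator A (F (\<beta>, \<omega>)) \<partial>past) \<in> borel_measurable borel"
        by (rule past.borel_measurable_nn_integral)
    qed measurable
    finally show ?thesis
      by (simp only: piv)
  qed
  ultimately show ?thesis by blast
qed

end

theorem theorem2p4:
  fixes p :: "int^'d::finite \<Rightarrow> real"
    and \<mu> :: "real measure"
    and \<nu> :: "(int^'d \<Rightarrow> real^'d) measure"
    and u :: "int^'d \<Rightarrow> real^'d"
  assumes kern: "kernel p"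
    and noise: "prob_space \<mu>" "sets \<mu> = sets borel" "integrable \<mu> (\<lambda>s. s)"
       "(\<integral>s. s \<partial>\<mu>) = 0" "integrable \<mu> (\<lambda>s. s ^ 2)"
    and inv: "invariant p \<mu> \<nu>"
    and integ: "\<forall>x. integrable \<nu> (\<lambda>eta. eta x)"
    and harm: "harmonic p u"
    and lim: "(dev \<nu> u \<longlongrightarrow> 0) at_top"
  shows "(dev \<nu> (\<lambda>x. \<integral>eta. eta x \<partial>\<nu>) \<longlongrightarrow> 0) at_top \<and>
         (\<exists>\<gamma> :: (real^'d) measure. prob_space \<gamma> \<and> sets \<gamma> = sets borel \<and>
            (\<forall>A\<in>sets CS. emeasure \<nu> A =
               (\<integral>\<^sup>+ \<alpha>. emeasure (piv p \<mu> (\<lambda>x. (\<integral>eta. eta x \<partial>\<nu>) + \<alpha>)) A \<partial>\<gamma>)))"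
proof -
  interpret sublinear_chain p \<mu> \<nu> u
    by (intro sublinear_chain.intro stationary_chain.intro incr_chain.intro rw_kernel.intro
        incr_chain_axioms.intro stationary_chain_axioms.intro sublinear_chain_axioms.intro
        kern noise inv harm lim integ[rule_format])
  have "mean = (\<lambda>x. \<integral>eta. eta x \<partial>\<nu>)"
    by (simp add: fun_eq_iff mean_def)
  with dev_mean_tendsto mixture show ?thesis
    by (simp only: simp_thms)
qed

end
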